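(* Let $R$ be a ring, let $\tau_1,\tau_2$ be automorphisms of $R$, let $\delta_1$ be a left $\tau_1$-derivation of $R$ and $\delta_2$ a left $\tau_2$-derivation of $R$, and let $S=R[x;\tau_1,\delta_1]*_R R[y;\tau_2,\delta_2]$. If $R$ is prime, then $S$ is prime also.
   Context: Rings are associative and unital. For a ring endomorphism $\tau$ of $R$, a left $\tau$-derivation is a $\mathbb{Z}$-linear map $\delta:R\to R$ with $\delta(rs)=\tau(r)\delta(s)+\delta(r)s$ for all $r,s\in R$. The Ore extension $R[x;\tau,\delta]$ is the ring containing $R$ as a subring that is a free left $R$-module with basis $\{1,x,x^2,\dots\}$ and satisfies $xr=\tau(r)x+\delta(r)$ for all $r\in R$. The amalgamated product $S_1*_RS_2$ of two rings $S_1,S_2$ containing $R$ as a subring is the pushout, in the category of rings, of the inclusions $R\hookrightarrow S_1$ and $R\hookrightarrow S_2$. *)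

theory Defs
  imports "HOL-Algebra.QuotRing" "HOL-Algebra.Ideal_Product"
begin

section \<open>Prime rings\<close>

text \<open>
  The library's \<^locale>\<open>primeideal\<close> presupposes commutativity, so primeness is defined here for
  arbitrary rings: the zero ideal is a prime ideal, i.e. it is proper and a product of two-sided
  ideals vanishes only if one of the factors does.
\<close>

locale prime_ring = ring R for R (structure) +
  assumes one_neq_zero: "\<one> \<noteq> \<zero>"
    and prime: "\<lbrakk>ideal I R; ideal J R; I \<cdot> J = {\<zero>}\<rbrakk> \<Longrightarrow> I = {\<zero>} \<or> J = {\<zero>}"

lemma (in ring) ideal_left_annihilated:
  assumes "b \<in> carrier R"
  shows "ideal {u \<in> carrier R. \<forall>r\<in>carrier R. u \<otimes> r \<otimes> b = \<zero>} R"
proof (rule idealI[OF ring_axioms])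
  let ?I = "{u \<in> carrier R. \<forall>r\<in>carrier R. u \<otimes> r \<otimes> b = \<zero>}"
  show "subgroup ?I (add_monoid R)"
  proof (rule add.subgroupI)
    show "?I \<noteq> {}"
      using assms by (auto intro!: exI[of _ \<zero>])
  qed (use assms in \<open>auto simp: l_minus l_distr\<close>)
  show "x \<otimes> a \<in> ?I" if "a \<in> ?I" "x \<in> carrier R" for a x
    using that assms by (auto simp: m_assoc)
  show "a \<otimes> x \<in> ?I" if "a \<in> ?I" "x \<in> carrier R" for a x
    using that assms by (auto simp: m_assoc[of a x])
qed

lemma (in ring) ideal_right_annihilated:
  assumes "I \<subseteq> carrier R"
  shows "ideal {v \<in> carrier R. \<forall>u\<in>I. \<forall>r\<in>carrier R. u \<otimes> r \<otimes> v = \<zero>} R"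
proof (rule idealI[OF ring_axioms])
  let ?J = "{v \<in> carrier R. \<forall>u\<in>I. \<forall>r\<in>carrier R. u \<otimes> r \<otimes> v = \<zero>}"
  have I: "u \<in> carrier R" if "u \<in> I" for u
    using that assms by blast
  show "subgroup ?J (add_monoid R)"
  proof (rule add.subgroupI)
    show "?J \<noteq> {}"
      using I by (auto intro!: exI[of _ \<zero>])
  qed (use I in \<open>auto simp: r_minus r_distr\<close>)
  show "a \<otimes> x \<in> ?J" if "a \<in> ?J" "x \<in> carrier R" for a x
    using that I by (auto simp: m_assoc[symmetric])
  show "x \<otimes> a \<in> ?J" if "a \<in> ?J" "x \<in> carrier R" for a x
  proof -
    have "u \<otimes> r \<otimes> (x \<otimes> a) = \<zero>" if "u \<in> I" "r \<in> carrier R" for u r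
    proof -
      have "u \<otimes> r \<otimes> (x \<otimes> a) = u \<otimes> (r \<otimes> x) \<otimes> a"
        using that \<open>a \<in> ?J\<close> \<open>x \<in> carrier R\<close> I by (simp add: m_assoc)
      then show ?thesis
        using that \<open>a \<in> ?J\<close> \<open>x \<in> carrier R\<close> by auto
    qed
    then show ?thesis
      using that by auto
  qed
qed

lemma (in ring) prime_ring_iff:
  "prime_ring R \<longleftrightarrow> \<one> \<noteq> \<zero> \<and>
    (\<forall>a\<in>carrier R. \<forall>b\<in>carrier R. (\<forall>r\<in>carrier R. a \<otimes> r \<otimes> b = \<zero>) \<longrightarrow> a = \<zero> \<or> b = \<zero>)"
  (is "_ \<longleftrightarrow> _ \<and> ?P")
proof (intro iffI conjI ballI impI)
  assume "prime_ring R"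
  then interpret prime_ring R .
  show "\<one> \<noteq> \<zero>" by (rule one_neq_zero)
  fix a b
  assume a: "a \<in> carrier R" and b: "b \<in> carrier R"
    and ann: "\<forall>r\<in>carrier R. a \<otimes> r \<otimes> b = \<zero>"
  let ?I = "{u \<in> carrier R. \<forall>r\<in>carrier R. u \<otimes> r \<otimes> b = \<zero>}"
  let ?J = "{v \<in> carrier R. \<forall>u\<in>?I. \<forall>r\<in>carrier R. u \<otimes> r \<otimes> v = \<zero>}"
  have I: "ideal ?I R"
    by (rule ideal_left_annihilated[OF b])
  have J: "ideal ?J R"
    by (rule ideal_right_annihilated) auto
  have "x = \<zero>" if "x \<in> ?I \<cdot> ?J" for x
    using that
  proof (induction rule: ideal_prod.induct)
    case (prod i j)
    then have "i \<otimes> \<one> \<otimes> j = \<zero>" by blast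
    then show ?case using prod by simp
  qed simp
  moreover have "\<zero> \<in> ?I \<cdot> ?J"
    using ideal_prod_is_ideal[OF I J] by (simp add: additive_subgroup.zero_closed ideal.axioms(1))
  ultimately have "?I \<cdot> ?J = {\<zero>}" by blast
  with prime[OF I J] have "?I = {\<zero>} \<or> ?J = {\<zero>}" by blast
  moreover have "a \<in> ?I" using a ann by blast
  moreover have "b \<in> ?J" using b by blast
  ultimately show "a = \<zero> \<or> b = \<zero>" by blast
next
  assume *: "\<one> \<noteq> \<zero> \<and> ?P"
  show "prime_ring R"
  proof
    show "\<one> \<noteq> \<zero>" using * by blast
    fix I J assume I: "ideal I R" and J: "ideal J R" and IJ: "I \<cdot> J = {\<zero>}"
    interpret I: ideal I R by fact
    interpret J: ideal J R by fact
    show "I = {\<zero>} \<or> J = {\<zero>}"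
    proof (rule ccontr)
      assume "\<not> ?thesis"
      then obtain a b where ab: "a \<in> I" "a \<noteq> \<zero>" "b \<in> J" "b \<noteq> \<zero>"
        using I.zero_closed J.zero_closed by blast
      have "a \<otimes> r \<otimes> b = \<zero>" if "r \<in> carrier R" for r
        using ideal_prod.prod[of "a \<otimes> r" I b J R] IJ ab that I.I_r_closed by blast
      then show False using * ab I.Icarr J.Icarr by blast
    qed
  qed
qed


section \<open>Ore extensions\<close>

definition left_derivation :: "'a ring \<Rightarrow> ('a \<Rightarrow> 'a) \<Rightarrow> ('a \<Rightarrow> 'a) \<Rightarrow> bool" where
  "left_derivation R \<tau> \<delta> \<longleftrightarrow>
     (\<forall>r\<in>carrier R. \<delta> r \<in> carrier R) \<and>
     (\<forall>r\<in>carrier R. \<forall>s\<in>carrier R. \<delta> (r \<oplus>\<^bsub>R\<^esub> s) = \<delta> r \<oplus>\<^bsub>R\<^esub> \<delta> s) \<and>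
     (\<forall>r\<in>carrier R. \<forall>s\<in>carrier R. \<delta> (r \<otimes>\<^bsub>R\<^esub> s) = \<tau> r \<otimes>\<^bsub>R\<^esub> \<delta> s \<oplus>\<^bsub>R\<^esub> \<delta> r \<otimes>\<^bsub>R\<^esub> s)"

text \<open>
  \<open>S\<close> is an Ore extension \<open>R[x; \<tau>, \<delta>]\<close>. The inclusion of \<open>R\<close> is an injective ring homomorphism
  \<open>\<iota>\<close>. That \<open>1, x, x\<^sup>2, \<dots>\<close> is a basis of \<open>S\<close> as a left \<open>R\<close>-module is the unique existence of
  finitely supported coefficients \<open>c\<close> for each element.
\<close>

definition ore_extension ::
  "'a ring \<Rightarrow> ('a \<Rightarrow> 'a) \<Rightarrow> ('a \<Rightarrow> 'a) \<Rightarrow> ('a \<Rightarrow> 'b) \<Rightarrow> 'b ring \<Rightarrow> 'b \<Rightarrow> bool" where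
  "ore_extension R \<tau> \<delta> \<iota> S x \<longleftrightarrow>
     ring S \<and> \<iota> \<in> ring_hom R S \<and> inj_on \<iota> (carrier R) \<and> x \<in> carrier S \<and>
     (\<forall>s\<in>carrier S. \<exists>!c :: nat \<Rightarrow> 'a.
        range c \<subseteq> carrier R \<and> finite {n. c n \<noteq> \<zero>\<^bsub>R\<^esub>} \<and>
        s = (\<Oplus>\<^bsub>S\<^esub>n\<in>{n. c n \<noteq> \<zero>\<^bsub>R\<^esub>}. \<iota> (c n) \<otimes>\<^bsub>S\<^esub> x [^]\<^bsub>S\<^esub> n)) \<and>
     (\<forall>r\<in>carrier R. x \<otimes>\<^bsub>S\<^esub> \<iota> r = \<iota> (\<tau> r) \<otimes>\<^bsub>S\<^esub> x \<oplus>\<^bsub>S\<^esub> \<iota> (\<delta> r))"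


section \<open>Amalgamated products\<close>

text \<open>
  The universal property of the pushout square
  \<open>\<kappa>\<^sub>1 \<circ> \<iota>\<^sub>1 = \<kappa>\<^sub>2 \<circ> \<iota>\<^sub>2\<close> with corner \<open>P\<close>, for all test rings with carrier in the type \<open>'t\<close>.
\<close>

definition pushout_universal ::
  "'t itself \<Rightarrow> 'a ring \<Rightarrow> ('a \<Rightarrow> 'b) \<Rightarrow> 'b ring \<Rightarrow> ('a \<Rightarrow> 'c) \<Rightarrow> 'c ring \<Rightarrow>
    ('b \<Rightarrow> 's) \<Rightarrow> ('c \<Rightarrow> 's) \<Rightarrow> 's ring \<Rightarrow> bool" where
  "pushout_universal _ R \<iota>\<^sub>1 S\<^sub>1 \<iota>\<^sub>2 S\<^sub>2 \<kappa>\<^sub>1 \<kappa>\<^sub>2 P \<longleftrightarrow>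
     (\<forall>(T :: 't ring) f g.
        ring T \<and> f \<in> ring_hom S\<^sub>1 T \<and> g \<in> ring_hom S\<^sub>2 T \<and>
        (\<forall>r\<in>carrier R. f (\<iota>\<^sub>1 r) = g (\<iota>\<^sub>2 r)) \<longrightarrow>
        (\<exists>h \<in> ring_hom P T.
           (\<forall>a\<in>carrier S\<^sub>1. h (\<kappa>\<^sub>1 a) = f a) \<and> (\<forall>b\<in>carrier S\<^sub>2. h (\<kappa>\<^sub>2 b) = g b) \<and>
           (\<forall>h' \<in> ring_hom P T.
              (\<forall>a\<in>carrier S\<^sub>1. h' (\<kappa>\<^sub>1 a) = f a) \<and> (\<forall>b\<in>carrier S\<^sub>2. h' (\<kappa>\<^sub>2 b) = g b) \<longrightarrow>
              (\<forall>p\<in>carrier P. h' p = h p))))"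

lemma pushout_universal_exists:
  fixes T :: "'t ring"
  assumes "pushout_universal TYPE('t) R \<iota>\<^sub>1 S\<^sub>1 \<iota>\<^sub>2 S\<^sub>2 \<kappa>\<^sub>1 \<kappa>\<^sub>2 P"
    and "ring T" "f \<in> ring_hom S\<^sub>1 T" "g \<in> ring_hom S\<^sub>2 T"
    and "\<forall>r\<in>carrier R. f (\<iota>\<^sub>1 r) = g (\<iota>\<^sub>2 r)"
  shows "\<exists>h \<in> ring_hom P T.
    (\<forall>a\<in>carrier S\<^sub>1. h (\<kappa>\<^sub>1 a) = f a) \<and> (\<forall>b\<in>carrier S\<^sub>2. h (\<kappa>\<^sub>2 b) = g b)"
proof -
  have "ring T \<and> f \<in> ring_hom S\<^sub>1 T \<and> g \<in> ring_hom S\<^sub>2 T \<and>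
      (\<forall>r\<in>carrier R. f (\<iota>\<^sub>1 r) = g (\<iota>\<^sub>2 r))"
    using assms by blast
  from assms(1)[unfolded pushout_universal_def, THEN spec, THEN spec, THEN spec, THEN mp, OF this]
  show ?thesis
    by (elim bexE conjE) (rule bexI, rule conjI)
qed

lemma pushout_universal_unique:
  fixes T :: "'t ring"
  assumes "pushout_universal TYPE('t) R \<iota>\<^sub>1 S\<^sub>1 \<iota>\<^sub>2 S\<^sub>2 \<kappa>\<^sub>1 \<kappa>\<^sub>2 P"
    and "ring T" "f \<in> ring_hom S\<^sub>1 T" "g \<in> ring_hom S\<^sub>2 T"
    and "\<forall>r\<in>carrier R. f (\<iota>\<^sub>1 r) = g (\<iota>\<^sub>2 r)"
    and h: "h \<in> ring_hom P T" "\<forall>a\<in>carrier S\<^sub>1. h (\<kappa>\<^sub>1 a) = f a" "\<forall>b\<in>carrier S\<^sub>2. h (\<kappa>\<^sub>2 b) = g b"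
    and h': "h' \<in> ring_hom P T" "\<forall>a\<in>carrier S\<^sub>1. h' (\<kappa>\<^sub>1 a) = f a" "\<forall>b\<in>carrier S\<^sub>2. h' (\<kappa>\<^sub>2 b) = g b"
    and p: "p \<in> carrier P"
  shows "h p = h' p"
proof -
  have "ring T \<and> f \<in> ring_hom S\<^sub>1 T \<and> g \<in> ring_hom S\<^sub>2 T \<and>
      (\<forall>r\<in>carrier R. f (\<iota>\<^sub>1 r) = g (\<iota>\<^sub>2 r))"
    using assms by blast
  from assms(1)[unfolded pushout_universal_def, THEN spec, THEN spec, THEN spec, THEN mp, OF this]
  obtain h0 where *: "\<forall>h' \<in> ring_hom P T.
      (\<forall>a\<in>carrier S\<^sub>1. h' (\<kappa>\<^sub>1 a) = f a) \<and> (\<forall>b\<in>carrier S\<^sub>2. h' (\<kappa>\<^sub>2 b) = g b) \<longrightarrow>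
      (\<forall>p\<in>carrier P. h' p = h0 p)"
    by (elim bexE conjE)
  from bspec[OF bspec[OF *, OF h(1), THEN mp] p] bspec[OF bspec[OF *, OF h'(1), THEN mp] p]
  show ?thesis using h(2,3) h'(2,3) by simp
qed

text \<open>
  Terms denoting elements of a ring that receives maps from rings of types \<open>'b\<close> and \<open>'c\<close>. The
  constants 0 and 1 and negation need no constructors, as they come from the two rings.
\<close>

datatype ('b, 'c) ring_term =
    Gen1 'b
  | Gen2 'c
  | Add "('b, 'c) ring_term" "('b, 'c) ring_term"
  | Mul "('b, 'c) ring_term" "('b, 'c) ring_term"

text \<open>
  HOL cannot quantify over all types inside a formula, so the definition below demands the
  universal property for two types of test rings only: the type of the pushout itself, and the type
  of sets of terms, where a pushout can always be constructed from generators and relations.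
  This is no restriction: \<open>amalgamated_product_universal\<close> derives from it the
  universal property for test rings of every type (given that the \<open>\<iota>\<^sub>i\<close> are ring homomorphisms),
  and \<open>amalgamated_product_exists\<close> shows that
  the definition can be met.
\<close>

definition amalgamated_product ::
  "'a ring \<Rightarrow> ('a \<Rightarrow> 'b) \<Rightarrow> 'b ring \<Rightarrow> ('a \<Rightarrow> 'c) \<Rightarrow> 'c ring \<Rightarrow>
    ('b \<Rightarrow> 's) \<Rightarrow> ('c \<Rightarrow> 's) \<Rightarrow> 's ring \<Rightarrow> bool" where
  "amalgamated_product R \<iota>\<^sub>1 S\<^sub>1 \<iota>\<^sub>2 S\<^sub>2 \<kappa>\<^sub>1 \<kappa>\<^sub>2 P \<longleftrightarrow>
     ring P \<and> \<kappa>\<^sub>1 \<in> ring_hom S\<^sub>1 P \<and> \<kappa>\<^sub>2 \<in> ring_hom S\<^sub>2 P \<and>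
     (\<forall>r\<in>carrier R. \<kappa>\<^sub>1 (\<iota>\<^sub>1 r) = \<kappa>\<^sub>2 (\<iota>\<^sub>2 r)) \<and>
     pushout_universal TYPE('s) R \<iota>\<^sub>1 S\<^sub>1 \<iota>\<^sub>2 S\<^sub>2 \<kappa>\<^sub>1 \<kappa>\<^sub>2 P \<and>
     pushout_universal TYPE(('b, 'c) ring_term set) R \<iota>\<^sub>1 S\<^sub>1 \<iota>\<^sub>2 S\<^sub>2 \<kappa>\<^sub>1 \<kappa>\<^sub>2 P"

subsection \<open>Construction by generators and relations\<close>

locale amalgam =
  fixes R :: "'a ring" and S1 :: "'b ring" and S2 :: "'c ring"
    and i1 :: "'a \<Rightarrow> 'b" and i2 :: "'a \<Rightarrow> 'c"
  assumes ring_S1: "ring S1" and ring_S2: "ring S2"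
    and i1_hom: "i1 \<in> ring_hom R S1" and i2_hom: "i2 \<in> ring_hom R S2"
begin

sublocale S1: ring S1 by (rule ring_S1)
sublocale S2: ring S2 by (rule ring_S2)

primrec wf_term :: "('b, 'c) ring_term \<Rightarrow> bool" where
  "wf_term (Gen1 a) \<longleftrightarrow> a \<in> carrier S1"
| "wf_term (Gen2 b) \<longleftrightarrow> b \<in> carrier S2"
| "wf_term (Add s t) \<longleftrightarrow> wf_term s \<and> wf_term t"
| "wf_term (Mul s t) \<longleftrightarrow> wf_term s \<and> wf_term t"

inductive eqv :: "('b, 'c) ring_term \<Rightarrow> ('b, 'c) ring_term \<Rightarrow> bool" where
  refl: "wf_term s \<Longrightarrow> eqv s s"
| sym: "eqv s t \<Longrightarrow> eqv t s"
| trans: "eqv s t \<Longrightarrow> eqv t u \<Longrightarrow> eqv s u"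
| add_cong: "eqv s s' \<Longrightarrow> eqv t t' \<Longrightarrow> eqv (Add s t) (Add s' t')"
| mul_cong: "eqv s s' \<Longrightarrow> eqv t t' \<Longrightarrow> eqv (Mul s t) (Mul s' t')"
| add_assoc: "wf_term s \<Longrightarrow> wf_term t \<Longrightarrow> wf_term u \<Longrightarrow> eqv (Add (Add s t) u) (Add s (Add t u))"
| add_comm: "wf_term s \<Longrightarrow> wf_term t \<Longrightarrow> eqv (Add s t) (Add t s)"
| add_zero: "wf_term s \<Longrightarrow> eqv (Add (Gen1 \<zero>\<^bsub>S1\<^esub>) s) s"
| add_neg: "wf_term s \<Longrightarrow> eqv (Add (Mul (Gen1 (\<ominus>\<^bsub>S1\<^esub> \<one>\<^bsub>S1\<^esub>)) s) s) (Gen1 \<zero>\<^bsub>S1\<^esub>)"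
| mul_assoc: "wf_term s \<Longrightarrow> wf_term t \<Longrightarrow> wf_term u \<Longrightarrow> eqv (Mul (Mul s t) u) (Mul s (Mul t u))"
| mul_one_left: "wf_term s \<Longrightarrow> eqv (Mul (Gen1 \<one>\<^bsub>S1\<^esub>) s) s"
| mul_one_right: "wf_term s \<Longrightarrow> eqv (Mul s (Gen1 \<one>\<^bsub>S1\<^esub>)) s"
| distr_left: "wf_term s \<Longrightarrow> wf_term t \<Longrightarrow> wf_term u \<Longrightarrow> eqv (Mul (Add s t) u) (Add (Mul s u) (Mul t u))"
| distr_right: "wf_term s \<Longrightarrow> wf_term t \<Longrightarrow> wf_term u \<Longrightarrow> eqv (Mul u (Add s t)) (Add (Mul u s) (Mul u t))"
| gen1_add: "a \<in> carrier S1 \<Longrightarrow> b \<in> carrier S1 \<Longrightarrow> eqv (Gen1 (a \<oplus>\<^bsub>S1\<^esub> b)) (Add (Gen1 a) (Gen1 b))"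
| gen1_mul: "a \<in> carrier S1 \<Longrightarrow> b \<in> carrier S1 \<Longrightarrow> eqv (Gen1 (a \<otimes>\<^bsub>S1\<^esub> b)) (Mul (Gen1 a) (Gen1 b))"
| gen2_add: "a \<in> carrier S2 \<Longrightarrow> b \<in> carrier S2 \<Longrightarrow> eqv (Gen2 (a \<oplus>\<^bsub>S2\<^esub> b)) (Add (Gen2 a) (Gen2 b))"
| gen2_mul: "a \<in> carrier S2 \<Longrightarrow> b \<in> carrier S2 \<Longrightarrow> eqv (Gen2 (a \<otimes>\<^bsub>S2\<^esub> b)) (Mul (Gen2 a) (Gen2 b))"
| gen2_one: "eqv (Gen2 \<one>\<^bsub>S2\<^esub>) (Gen1 \<one>\<^bsub>S1\<^esub>)"
| amalg: "r \<in> carrier R \<Longrightarrow> eqv (Gen1 (i1 r)) (Gen2 (i2 r))"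

lemma eqv_wf: "eqv s t \<Longrightarrow> wf_term s \<and> wf_term t"
  by (induction rule: eqv.induct)
    (auto intro: ring_hom_closed[OF i1_hom] ring_hom_closed[OF i2_hom])

definition cls :: "('b, 'c) ring_term \<Rightarrow> ('b, 'c) ring_term set" where
  "cls s = {t. eqv s t}"

definition rep :: "('b, 'c) ring_term set \<Rightarrow> ('b, 'c) ring_term" where
  "rep A = (SOME s. s \<in> A)"

lemma cls_eqI: "eqv s t \<Longrightarrow> cls s = cls t"
  unfolding cls_def using eqv.sym eqv.trans by blast

lemma eqv_rep: "wf_term s \<Longrightarrow> eqv s (rep (cls s))"
  unfolding rep_def cls_def by (rule someI2[of _ s]) (auto intro: eqv.refl)

lemma cls_rep: "wf_term s \<Longrightarrow> cls (rep (cls s)) = cls s"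
  using cls_eqI[OF eqv_rep] by simp

definition P :: "('b, 'c) ring_term set ring" where
  "P = \<lparr>carrier = cls ` {s. wf_term s},
        monoid.mult = (\<lambda>A B. cls (Mul (rep A) (rep B))),
        one = cls (Gen1 \<one>\<^bsub>S1\<^esub>),
        zero = cls (Gen1 \<zero>\<^bsub>S1\<^esub>),
        add = (\<lambda>A B. cls (Add (rep A) (rep B)))\<rparr>"

lemma P_carrier: "carrier P = cls ` {s. wf_term s}"
  and P_one: "\<one>\<^bsub>P\<^esub> = cls (Gen1 \<one>\<^bsub>S1\<^esub>)"
  and P_zero: "\<zero>\<^bsub>P\<^esub> = cls (Gen1 \<zero>\<^bsub>S1\<^esub>)"
  by (simp_all add: P_def)

lemma P_mult: "wf_term s \<Longrightarrow> wf_term t \<Longrightarrow> cls s \<otimes>\<^bsub>P\<^esub> cls t = cls (Mul s t)"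
  by (simp add: P_def) (meson cls_eqI eqv.mul_cong eqv.sym eqv_rep)

lemma P_add: "wf_term s \<Longrightarrow> wf_term t \<Longrightarrow> cls s \<oplus>\<^bsub>P\<^esub> cls t = cls (Add s t)"
  by (simp add: P_def) (meson cls_eqI eqv.add_cong eqv.sym eqv_rep)

lemma ring_P: "ring P"
proof (rule ringI)
  show "abelian_group P"
  proof (rule abelian_groupI)
    show "x \<oplus>\<^bsub>P\<^esub> y = y \<oplus>\<^bsub>P\<^esub> x" if xy: "x \<in> carrier P" "y \<in> carrier P" for x y
    proof -
      obtain s t where "wf_term s" "x = cls s" "wf_term t" "y = cls t"
        using xy unfolding P_carrier by blast
      then show ?thesis
        by (simp only: P_add) (rule cls_eqI[OF eqv.add_comm])
    qed
    fix x assume "x \<in> carrier P"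
    then obtain s where s: "wf_term s" "x = cls s" by (auto simp: P_carrier)
    show "\<exists>y\<in>carrier P. y \<oplus>\<^bsub>P\<^esub> x = \<zero>\<^bsub>P\<^esub>"
      by (rule bexI[of _ "cls (Mul (Gen1 (\<ominus>\<^bsub>S1\<^esub> \<one>\<^bsub>S1\<^esub>)) s)"])
        (use s in \<open>auto simp: P_add P_zero P_carrier intro!: cls_eqI eqv.add_neg\<close>)
  qed (auto simp: P_carrier P_zero P_add
      cls_eqI[OF eqv.add_assoc] cls_eqI[OF eqv.add_zero])
  show "Group.monoid P"
    by (rule monoidI)
      (auto simp: P_carrier P_one P_mult
        cls_eqI[OF eqv.mul_assoc] cls_eqI[OF eqv.mul_one_left] cls_eqI[OF eqv.mul_one_right])
qed (auto simp: P_carrier P_add P_mult cls_eqI[OF eqv.distr_left] cls_eqI[OF eqv.distr_right])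

definition k1 :: "'b \<Rightarrow> ('b, 'c) ring_term set" where "k1 a = cls (Gen1 a)"
definition k2 :: "'c \<Rightarrow> ('b, 'c) ring_term set" where "k2 b = cls (Gen2 b)"

lemma k1_hom: "k1 \<in> ring_hom S1 P"
  by (rule ring_hom_memI)
    (auto simp: k1_def P_carrier P_add P_mult P_one intro!: cls_eqI eqv.gen1_add eqv.gen1_mul)

lemma k2_hom: "k2 \<in> ring_hom S2 P"
  by (rule ring_hom_memI)
    (auto simp: k2_def P_carrier P_add P_mult P_one
      intro!: cls_eqI eqv.gen2_add eqv.gen2_mul eqv.gen2_one)

lemma k_amalg: "r \<in> carrier R \<Longrightarrow> k1 (i1 r) = k2 (i2 r)"
  by (auto simp: k1_def k2_def intro!: cls_eqI eqv.amalg)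

primrec ev :: "('t, 'm) ring_scheme \<Rightarrow> ('b \<Rightarrow> 't) \<Rightarrow> ('c \<Rightarrow> 't) \<Rightarrow> ('b, 'c) ring_term \<Rightarrow> 't" where
  "ev T f g (Gen1 a) = f a"
| "ev T f g (Gen2 b) = g b"
| "ev T f g (Add s t) = ev T f g s \<oplus>\<^bsub>T\<^esub> ev T f g t"
| "ev T f g (Mul s t) = ev T f g s \<otimes>\<^bsub>T\<^esub> ev T f g t"

context
  fixes T :: "'t ring" and f g
  assumes ring_T: "ring T" and f_hom: "f \<in> ring_hom S1 T" and g_hom: "g \<in> ring_hom S2 T"
    and fg: "\<And>r. r \<in> carrier R \<Longrightarrow> f (i1 r) = g (i2 r)"
begin

interpretation T: ring T by (rule ring_T)
interpretation f: ring_hom_ring S1 T f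
  by (rule ring_hom_ringI2) (use ring_S1 ring_T f_hom in auto)

lemma ev_closed: "wf_term s \<Longrightarrow> ev T f g s \<in> carrier T"
  by (induction s) (auto simp: ring_hom_closed[OF f_hom] ring_hom_closed[OF g_hom])

lemma ev_eqv: "eqv s t \<Longrightarrow> ev T f g s = ev T f g t"
proof (induction rule: eqv.induct)
  case (add_neg s)
  then show ?case by (simp add: ev_closed T.l_minus T.l_neg)
qed (auto simp: ev_closed T.a_ac T.m_assoc T.l_distr T.r_distr
      ring_hom_add[OF g_hom] ring_hom_mult[OF g_hom] ring_hom_one[OF g_hom] fg)

lemma ev_rep: "wf_term s \<Longrightarrow> ev T f g (rep (cls s)) = ev T f g s"
  using ev_eqv[OF eqv_rep] by simp

lemma ev_hom: "(\<lambda>A. ev T f g (rep A)) \<in> ring_hom P T"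
  by (rule ring_hom_memI)
    (auto simp: P_carrier P_mult P_add P_one ev_rep ev_closed)

lemma hom_unique:
  assumes h: "h \<in> ring_hom P T"
    and "\<And>a. a \<in> carrier S1 \<Longrightarrow> h (k1 a) = f a" "\<And>b. b \<in> carrier S2 \<Longrightarrow> h (k2 b) = g b"
    and s: "wf_term s"
  shows "h (cls s) = ev T f g s"
  using s
proof (induction s)
  case (Add s t)
  then show ?case using ring_hom_add[OF h, of "cls s" "cls t"] by (auto simp: P_add P_carrier)
next
  case (Mul s t)
  then show ?case using ring_hom_mult[OF h, of "cls s" "cls t"] by (auto simp: P_mult P_carrier)
qed (use assms in \<open>auto simp: k1_def k2_def\<close>)

end

lemma P_universal: "pushout_universal TYPE('t) R i1 S1 i2 S2 k1 k2 P"
  unfolding pushout_universal_def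
proof (intro allI impI, elim conjE)
  fix T :: "'t ring" and f g
  assume T: "ring T" "f \<in> ring_hom S1 T" "g \<in> ring_hom S2 T"
    and "\<forall>r\<in>carrier R. f (i1 r) = g (i2 r)"
  then have fg: "\<And>r. r \<in> carrier R \<Longrightarrow> f (i1 r) = g (i2 r)" by blast
  show "\<exists>h \<in> ring_hom P T.
    (\<forall>a\<in>carrier S1. h (k1 a) = f a) \<and> (\<forall>b\<in>carrier S2. h (k2 b) = g b) \<and>
    (\<forall>h' \<in> ring_hom P T.
      (\<forall>a\<in>carrier S1. h' (k1 a) = f a) \<and> (\<forall>b\<in>carrier S2. h' (k2 b) = g b) \<longrightarrow>
      (\<forall>p\<in>carrier P. h' p = h p))"
  proof (rule bexI[OF _ ev_hom[OF T fg]], intro conjI ballI impI)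
    show "ev T f g (rep (k1 a)) = f a" if "a \<in> carrier S1" for a
      using that ev_rep[OF T fg, of "Gen1 a"] by (simp add: k1_def)
    show "ev T f g (rep (k2 b)) = g b" if "b \<in> carrier S2" for b
      using that ev_rep[OF T fg, of "Gen2 b"] by (simp add: k2_def)
    fix h p
    assume "h \<in> ring_hom P T" "p \<in> carrier P"
      and "(\<forall>a\<in>carrier S1. h (k1 a) = f a) \<and> (\<forall>b\<in>carrier S2. h (k2 b) = g b)"
    then show "h p = ev T f g (rep p)"
      using hom_unique[OF T fg, of h] ev_rep[OF T fg] by (auto simp: P_carrier)
  qed
qed

lemma P_amalgamated_product: "amalgamated_product R i1 S1 i2 S2 k1 k2 P"
  unfolding amalgamated_product_def
  using ring_P k1_hom k2_hom k_amalg P_universal by blast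

lemma universal_any_type:
  fixes Q :: "'s ring"
  assumes Q: "amalgamated_product R i1 S1 i2 S2 \<kappa>\<^sub>1 \<kappa>\<^sub>2 Q"
  shows "pushout_universal TYPE('t) R i1 S1 i2 S2 \<kappa>\<^sub>1 \<kappa>\<^sub>2 Q"
proof -
  have ring_Q: "ring Q" and \<kappa>: "\<kappa>\<^sub>1 \<in> ring_hom S1 Q" "\<kappa>\<^sub>2 \<in> ring_hom S2 Q"
    and \<kappa>_amalg: "\<forall>r\<in>carrier R. \<kappa>\<^sub>1 (i1 r) = \<kappa>\<^sub>2 (i2 r)"
    and univ_s: "pushout_universal TYPE('s) R i1 S1 i2 S2 \<kappa>\<^sub>1 \<kappa>\<^sub>2 Q"
    and univ_P: "pushout_universal TYPE(('b, 'c) ring_term set) R i1 S1 i2 S2 \<kappa>\<^sub>1 \<kappa>\<^sub>2 Q"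
    using Q by (simp_all add: amalgamated_product_def)
  have k_amalg': "\<forall>r\<in>carrier R. k1 (i1 r) = k2 (i2 r)"
    using k_amalg by blast
  obtain \<phi> where \<phi>: "\<phi> \<in> ring_hom Q P"
    "\<forall>a\<in>carrier S1. \<phi> (\<kappa>\<^sub>1 a) = k1 a" "\<forall>b\<in>carrier S2. \<phi> (\<kappa>\<^sub>2 b) = k2 b"
    using pushout_universal_exists[OF univ_P ring_P k1_hom k2_hom k_amalg'] by blast
  obtain \<psi> where \<psi>: "\<psi> \<in> ring_hom P Q"
    "\<forall>a\<in>carrier S1. \<psi> (k1 a) = \<kappa>\<^sub>1 a" "\<forall>b\<in>carrier S2. \<psi> (k2 b) = \<kappa>\<^sub>2 b"
    using pushout_universal_exists[OF P_universal ring_Q \<kappa> \<kappa>_amalg] by blast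
  have \<psi>\<phi>: "\<psi> (\<phi> q) = q" if "q \<in> carrier Q" for q
  proof -
    have "id \<in> ring_hom Q Q" by (rule ring_hom_memI) auto
    then have "(\<psi> \<circ> \<phi>) q = id q"
      by (rule pushout_universal_unique[OF univ_s ring_Q \<kappa> \<kappa>_amalg ring_hom_trans[OF \<phi>(1) \<psi>(1)],
            rotated 2])
        (use \<phi>(2,3) \<psi>(2,3) that in auto)
    then show ?thesis by simp
  qed
  show ?thesis
    unfolding pushout_universal_def
  proof (intro allI impI)
    fix T :: "'t ring" and f g
    assume "ring T \<and> f \<in> ring_hom S1 T \<and> g \<in> ring_hom S2 T \<and>
      (\<forall>r\<in>carrier R. f (i1 r) = g (i2 r))"
    then have T: "ring T" "f \<in> ring_hom S1 T" "g \<in> ring_hom S2 T"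
      "\<forall>r\<in>carrier R. f (i1 r) = g (i2 r)"
      by blast+
    obtain h where h: "h \<in> ring_hom P T"
      "\<forall>a\<in>carrier S1. h (k1 a) = f a" "\<forall>b\<in>carrier S2. h (k2 b) = g b"
      using pushout_universal_exists[OF P_universal T] by blast
    show "\<exists>h \<in> ring_hom Q T.
      (\<forall>a\<in>carrier S1. h (\<kappa>\<^sub>1 a) = f a) \<and> (\<forall>b\<in>carrier S2. h (\<kappa>\<^sub>2 b) = g b) \<and>
      (\<forall>h' \<in> ring_hom Q T.
        (\<forall>a\<in>carrier S1. h' (\<kappa>\<^sub>1 a) = f a) \<and> (\<forall>b\<in>carrier S2. h' (\<kappa>\<^sub>2 b) = g b) \<longrightarrow>
        (\<forall>p\<in>carrier Q. h' p = h p))"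
    proof (rule bexI[of _ "h \<circ> \<phi>"], intro conjI ballI impI)
      show "h \<circ> \<phi> \<in> ring_hom Q T" using \<phi>(1) h(1) by (rule ring_hom_trans)
      show "(h \<circ> \<phi>) (\<kappa>\<^sub>1 a) = f a" if "a \<in> carrier S1" for a using that \<phi>(2) h(2) by simp
      show "(h \<circ> \<phi>) (\<kappa>\<^sub>2 b) = g b" if "b \<in> carrier S2" for b using that \<phi>(3) h(3) by simp
      fix h' q
      assume h': "h' \<in> ring_hom Q T" and q: "q \<in> carrier Q"
        and gens: "(\<forall>a\<in>carrier S1. h' (\<kappa>\<^sub>1 a) = f a) \<and> (\<forall>b\<in>carrier S2. h' (\<kappa>\<^sub>2 b) = g b)"
      have "(h' \<circ> \<psi>) (\<phi> q) = h (\<phi> q)"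
        by (rule pushout_universal_unique[OF P_universal T ring_hom_trans[OF \<psi>(1) h'] _ _ h(1)])
          (use gens h(2,3) \<psi>(2,3) ring_hom_closed[OF \<phi>(1) q] in auto)
      then show "h' q = (h \<circ> \<phi>) q" using \<psi>\<phi>[OF q] by simp
    qed
  qed
qed

end

theorem amalgamated_product_universal:
  assumes "ring S\<^sub>1" "ring S\<^sub>2" "\<iota>\<^sub>1 \<in> ring_hom R S\<^sub>1" "\<iota>\<^sub>2 \<in> ring_hom R S\<^sub>2"
    and "amalgamated_product R \<iota>\<^sub>1 S\<^sub>1 \<iota>\<^sub>2 S\<^sub>2 \<kappa>\<^sub>1 \<kappa>\<^sub>2 P"
  shows "pushout_universal TYPE('t) R \<iota>\<^sub>1 S\<^sub>1 \<iota>\<^sub>2 S\<^sub>2 \<kappa>\<^sub>1 \<kappa>\<^sub>2 P"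
  using amalgam.universal_any_type[OF amalgam.intro] assms by blast

theorem amalgamated_product_exists:
  fixes S\<^sub>1 :: "'b ring" and S\<^sub>2 :: "'c ring"
  assumes "ring S\<^sub>1" "ring S\<^sub>2" "\<iota>\<^sub>1 \<in> ring_hom R S\<^sub>1" "\<iota>\<^sub>2 \<in> ring_hom R S\<^sub>2"
  shows "\<exists>\<kappa>\<^sub>1 \<kappa>\<^sub>2 (P :: ('b, 'c) ring_term set ring).
    amalgamated_product R \<iota>\<^sub>1 S\<^sub>1 \<iota>\<^sub>2 S\<^sub>2 \<kappa>\<^sub>1 \<kappa>\<^sub>2 P"
  using amalgam.P_amalgamated_product[OF amalgam.intro[OF assms]] by blast

end

theory Submission
  imports Defs "HOL-Algebra.Subrings"
begin

text \<open>
  The ring \<open>S\<close> is generated by \<open>R\<close> and two indeterminates \<open>x\<close> and \<open>y\<close>, subject only to the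
  commutation rules \<open>xr = \<tau>\<^sub>1(r)x + \<delta>\<^sub>1(r)\<close> and \<open>yr = \<tau>\<^sub>2(r)y + \<delta>\<^sub>2(r)\<close>. These rules move all
  coefficients to the left, so that \<open>S\<close> should be a free left \<open>R\<close>-module with the words in \<open>x\<close>
  and \<open>y\<close> as basis. Granted this, primeness follows by looking at leading terms. Let \<open>u\<close> and \<open>v\<close>
  be words of maximal length in nonzero elements \<open>a\<close> and \<open>b\<close>, with coefficients \<open>a\<^sub>u\<close> and \<open>b\<^sub>v\<close>.
  The terms involving \<open>\<delta>\<^sub>1\<close> or \<open>\<delta>\<^sub>2\<close> only shorten words, and a word factors in just one way
  into a prefix and a suffix of given lengths. Hence the coefficient of the word \<open>uv\<close> in \<open>arb\<close> is
  \<open>a\<^sub>u \<tau>\<^sub>u(r b\<^sub>v)\<close>, where \<open>\<tau>\<^sub>u\<close> is the composite of the automorphisms belonging to the letters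
  of \<open>u\<close>. As \<open>r\<close> runs through \<open>R\<close>, so does \<open>\<tau>\<^sub>u(r)\<close>, and \<open>\<tau>\<^sub>u(b\<^sub>v) \<noteq> 0\<close>. If \<open>arb\<close> vanished for
  all \<open>r \<in> R\<close>, then \<open>a\<^sub>u R \<tau>\<^sub>u(b\<^sub>v) = 0\<close>, against the primeness of \<open>R\<close>. So multipliers from
  \<open>R\<close> alone already witness that \<open>S\<close> is prime.

  The free basis comes from a representation of \<open>S\<close>. Let \<open>M\<close> be the additive group of all functions
  from words to \<open>R\<close>, thought of as formal left linear combinations of words. Elements of \<open>R\<close> act by left
  multiplication, and an indeterminate acts by the skew shift that the commutation rule dictates. These
  operators satisfy the commutation rules (\<open>skew_map_operators\<close>), so the universal properties of the
  Ore extensions (\<open>ore.universal\<close>) and of the pushout extend them to a ring homomorphism from \<open>S\<close>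
  to the additive endomorphisms of \<open>M\<close>. Applying \<open>s \<in> S\<close> to the empty word yields a family of
  coefficients. Conversely, sending a finitely supported family to the linear combination that it
  describes commutes with the action of \<open>R\<close>, \<open>x\<close> and \<open>y\<close>, hence with that of \<open>S\<close>, because these
  generate \<open>S\<close> (\<open>pushout_generated\<close>). Therefore every \<open>s\<close> is recovered from its coefficients
  (\<open>from_coeffs_coeffs\<close>). In particular, a nonzero element has a nonzero coefficient, and the leading
  coefficient of \<open>arb\<close> can be computed inside the representation (\<open>act_leading\<close>).
\<close>

section \<open>Function modules and their endomorphism rings\<close>

text \<open>
  The direct power of \<open>R\<close>, whose elements serve as formal left linear combinations of indices.
  Infinite support is allowed because the operators below are given by pointwise formulas.
\<close>

definition fun_ring :: "'a ring \<Rightarrow> ('w \<Rightarrow> 'a) ring" where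
  "fun_ring R = \<lparr>carrier = {f. \<forall>w. f w \<in> carrier R},
     monoid.mult = (\<lambda>f g w. f w \<otimes>\<^bsub>R\<^esub> g w), one = (\<lambda>w. \<one>\<^bsub>R\<^esub>),
     zero = (\<lambda>w. \<zero>\<^bsub>R\<^esub>), add = (\<lambda>f g w. f w \<oplus>\<^bsub>R\<^esub> g w)\<rparr>"

lemma fun_ring_simps:
  "f \<in> carrier (fun_ring R) \<longleftrightarrow> (\<forall>w. f w \<in> carrier R)"
  "\<zero>\<^bsub>fun_ring R\<^esub> = (\<lambda>w. \<zero>\<^bsub>R\<^esub>)"
  "f \<oplus>\<^bsub>fun_ring R\<^esub> g = (\<lambda>w. f w \<oplus>\<^bsub>R\<^esub> g w)"
  by (simp_all add: fun_ring_def)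

lemma abelian_group_fun_ring:
  assumes "ring R"
  shows "abelian_group (fun_ring R)"
proof -
  interpret R: ring R by fact
  show ?thesis
  proof (rule abelian_groupI)
    fix f assume "f \<in> carrier (fun_ring R)"
    then show "\<exists>g\<in>carrier (fun_ring R). g \<oplus>\<^bsub>fun_ring R\<^esub> f = \<zero>\<^bsub>fun_ring R\<^esub>"
      by (intro bexI[of _ "\<lambda>w. \<ominus>\<^bsub>R\<^esub> f w"]) (auto simp: fun_ring_simps R.l_neg)
  qed (auto simp: fun_ring_simps R.a_ac)
qed

text \<open>
  Additive endomorphisms take the value zero off the carrier, so that equal maps are equal functions.
  Zero, rather than an unspecified value, keeps the operators closed under pointwise sums and under
  plain composition: an additive map sends zero to zero.
\<close>

definition endo_ring :: "'m ring \<Rightarrow> ('m \<Rightarrow> 'm) ring" where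
  "endo_ring M = \<lparr>carrier = {\<phi>. (\<forall>f\<in>carrier M. \<phi> f \<in> carrier M) \<and>
       (\<forall>f\<in>carrier M. \<forall>g\<in>carrier M. \<phi> (f \<oplus>\<^bsub>M\<^esub> g) = \<phi> f \<oplus>\<^bsub>M\<^esub> \<phi> g) \<and>
       (\<forall>f. f \<notin> carrier M \<longrightarrow> \<phi> f = \<zero>\<^bsub>M\<^esub>)},
     monoid.mult = (\<circ>), one = (\<lambda>f. if f \<in> carrier M then f else \<zero>\<^bsub>M\<^esub>),
     zero = (\<lambda>f. \<zero>\<^bsub>M\<^esub>), add = (\<lambda>\<phi> \<psi> f. \<phi> f \<oplus>\<^bsub>M\<^esub> \<psi> f)\<rparr>"

lemma endo_ring_simps:
  "\<phi> \<in> carrier (endo_ring M) \<longleftrightarrow> (\<forall>f\<in>carrier M. \<phi> f \<in> carrier M) \<and>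
       (\<forall>f\<in>carrier M. \<forall>g\<in>carrier M. \<phi> (f \<oplus>\<^bsub>M\<^esub> g) = \<phi> f \<oplus>\<^bsub>M\<^esub> \<phi> g) \<and>
       (\<forall>f. f \<notin> carrier M \<longrightarrow> \<phi> f = \<zero>\<^bsub>M\<^esub>)"
  "\<phi> \<otimes>\<^bsub>endo_ring M\<^esub> \<psi> = \<phi> \<circ> \<psi>"
  "\<one>\<^bsub>endo_ring M\<^esub> = (\<lambda>f. if f \<in> carrier M then f else \<zero>\<^bsub>M\<^esub>)"
  "\<zero>\<^bsub>endo_ring M\<^esub> = (\<lambda>f. \<zero>\<^bsub>M\<^esub>)"
  "\<phi> \<oplus>\<^bsub>endo_ring M\<^esub> \<psi> = (\<lambda>f. \<phi> f \<oplus>\<^bsub>M\<^esub> \<psi> f)"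
  by (simp_all add: endo_ring_def)

lemma ring_endo_ring:
  assumes "abelian_group M"
  shows "ring (endo_ring M)"
proof -
  interpret abelian_group M by fact
  have closed: "\<phi> f \<in> carrier M" if "\<phi> \<in> carrier (endo_ring M)" for \<phi> f
    using that by (cases "f \<in> carrier M") (auto simp: endo_ring_simps)
  have zero: "\<phi> \<zero>\<^bsub>M\<^esub> = \<zero>\<^bsub>M\<^esub>" if "\<phi> \<in> carrier (endo_ring M)" for \<phi>
  proof -
    have "\<phi> (\<zero>\<^bsub>M\<^esub> \<oplus>\<^bsub>M\<^esub> \<zero>\<^bsub>M\<^esub>) = \<phi> \<zero>\<^bsub>M\<^esub> \<oplus>\<^bsub>M\<^esub> \<phi> \<zero>\<^bsub>M\<^esub>"
      using that unfolding endo_ring_simps by blast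
    then show ?thesis using closed[OF that, of "\<zero>\<^bsub>M\<^esub>"] by simp
  qed
  show ?thesis
  proof (rule ringI)
    show "abelian_group (endo_ring M)"
    proof (rule abelian_groupI)
      fix \<phi> \<psi> assume "\<phi> \<in> carrier (endo_ring M)" "\<psi> \<in> carrier (endo_ring M)"
      then show "\<phi> \<oplus>\<^bsub>endo_ring M\<^esub> \<psi> \<in> carrier (endo_ring M)"
        by (auto simp: endo_ring_simps a_ac)
    next
      fix \<phi> assume "\<phi> \<in> carrier (endo_ring M)"
      then show "\<exists>\<psi>\<in>carrier (endo_ring M). \<psi> \<oplus>\<^bsub>endo_ring M\<^esub> \<phi> = \<zero>\<^bsub>endo_ring M\<^esub>"
        using closed
        by (intro bexI[of _ "\<lambda>f. \<ominus>\<^bsub>M\<^esub> \<phi> f"]) (auto simp: endo_ring_simps l_neg minus_add)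
    next
      show "\<zero>\<^bsub>endo_ring M\<^esub> \<in> carrier (endo_ring M)" by (auto simp: endo_ring_simps)
    qed (use closed in \<open>auto simp: endo_ring_simps(2-5) a_ac\<close>)
    show "Group.monoid (endo_ring M)"
    proof (rule monoidI)
      fix \<phi> \<psi> assume "\<phi> \<in> carrier (endo_ring M)" "\<psi> \<in> carrier (endo_ring M)"
      then show "\<phi> \<otimes>\<^bsub>endo_ring M\<^esub> \<psi> \<in> carrier (endo_ring M)"
        using zero[of \<phi>] by (auto simp: endo_ring_simps)
    next
      fix \<phi> assume \<phi>: "\<phi> \<in> carrier (endo_ring M)"
      then show "\<one>\<^bsub>endo_ring M\<^esub> \<otimes>\<^bsub>endo_ring M\<^esub> \<phi> = \<phi>"
        using closed[OF \<phi>] by (auto simp: endo_ring_simps(2-5))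
      show "\<phi> \<otimes>\<^bsub>endo_ring M\<^esub> \<one>\<^bsub>endo_ring M\<^esub> = \<phi>"
        using \<phi> zero[OF \<phi>] by (auto simp: endo_ring_simps)
    qed (auto simp: endo_ring_simps)
    fix \<phi> \<psi> \<chi> assume *: "\<phi> \<in> carrier (endo_ring M)" "\<psi> \<in> carrier (endo_ring M)"
      "\<chi> \<in> carrier (endo_ring M)"
    show "(\<phi> \<oplus>\<^bsub>endo_ring M\<^esub> \<psi>) \<otimes>\<^bsub>endo_ring M\<^esub> \<chi> =
        \<phi> \<otimes>\<^bsub>endo_ring M\<^esub> \<chi> \<oplus>\<^bsub>endo_ring M\<^esub> \<psi> \<otimes>\<^bsub>endo_ring M\<^esub> \<chi>"
      by (auto simp: endo_ring_simps)
    have "\<chi> (\<phi> f \<oplus>\<^bsub>M\<^esub> \<psi> f) = \<chi> (\<phi> f) \<oplus>\<^bsub>M\<^esub> \<chi> (\<psi> f)" for f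
      using *(3) closed[OF *(1)] closed[OF *(2)] by (auto simp: endo_ring_simps)
    then show "\<chi> \<otimes>\<^bsub>endo_ring M\<^esub> (\<phi> \<oplus>\<^bsub>endo_ring M\<^esub> \<psi>) =
        \<chi> \<otimes>\<^bsub>endo_ring M\<^esub> \<phi> \<oplus>\<^bsub>endo_ring M\<^esub> \<chi> \<otimes>\<^bsub>endo_ring M\<^esub> \<psi>"
      by (auto simp: endo_ring_simps(2-5))
  qed
qed


section \<open>Skew derivations and the skew shift\<close>

locale skew_derivation = R: ring R for R :: "'a ring" (structure) +
  fixes \<tau> \<delta> :: "'a \<Rightarrow> 'a"
  assumes \<tau>_hom: "\<tau> \<in> ring_hom R R"
    and derivation: "left_derivation R \<tau> \<delta>"
begin

lemma \<delta>_closed [simp]: "r \<in> carrier R \<Longrightarrow> \<delta> r \<in> carrier R"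
  and \<delta>_add: "r \<in> carrier R \<Longrightarrow> s \<in> carrier R \<Longrightarrow> \<delta> (r \<oplus> s) = \<delta> r \<oplus> \<delta> s"
  and \<delta>_mult: "r \<in> carrier R \<Longrightarrow> s \<in> carrier R \<Longrightarrow> \<delta> (r \<otimes> s) = \<tau> r \<otimes> \<delta> s \<oplus> \<delta> r \<otimes> s"
  using derivation by (auto simp: left_derivation_def)

lemmas \<tau>_closed [simp] = ring_hom_closed[OF \<tau>_hom]
lemmas \<tau>_add = ring_hom_add[OF \<tau>_hom]
lemmas \<tau>_mult = ring_hom_mult[OF \<tau>_hom]

lemma \<tau>_zero [simp]: "\<tau> \<zero> = \<zero>"
  using ring_hom_zero[OF \<tau>_hom R.ring_axioms R.ring_axioms] .

lemma \<delta>_zero [simp]: "\<delta> \<zero> = \<zero>"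
  using \<delta>_add[of \<zero> \<zero>] by simp

text \<open>
  This is left multiplication by an indeterminate \<open>x\<close> in terms of coefficients. If \<open>xw\<close> is the basis
  element \<open>\<sigma> w\<close>, then \<open>x (\<Sum> f(w) w) = \<Sum> (\<tau>(f(w)) \<sigma> w + \<delta>(f(w)) w)\<close>. The index map is \<open>Suc\<close> for powers
  of one indeterminate and \<open>Cons i\<close> for words.
\<close>

definition shift :: "('w \<Rightarrow> 'w) \<Rightarrow> ('w \<Rightarrow> 'a) \<Rightarrow> 'w \<Rightarrow> 'a" where
  "shift \<sigma> f w = (if w \<in> range \<sigma> then \<tau> (f (inv_into UNIV \<sigma> w)) else \<zero>) \<oplus> \<delta> (f w)"

lemma shift_closed: "(\<And>w. f w \<in> carrier R) \<Longrightarrow> shift \<sigma> f w \<in> carrier R"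
  by (simp add: shift_def)

lemma shift_add:
  assumes "\<And>w. f w \<in> carrier R" "\<And>w. g w \<in> carrier R"
  shows "shift \<sigma> (\<lambda>w. f w \<oplus> g w) = (\<lambda>w. shift \<sigma> f w \<oplus> shift \<sigma> g w)"
  using assms by (auto simp: shift_def \<tau>_add \<delta>_add R.a_ac)

text \<open>
  The commutation rule \<open>xr = \<tau>(r)x + \<delta>(r)\<close> for the shift: it is where the Leibniz rule for \<open>\<delta>\<close> is used.
\<close>

lemma shift_smult:
  assumes "\<And>w. f w \<in> carrier R" "r \<in> carrier R"
  shows "shift \<sigma> (\<lambda>w. r \<otimes> f w) = (\<lambda>w. \<tau> r \<otimes> shift \<sigma> f w \<oplus> \<delta> r \<otimes> f w)"
  using assms by (auto simp: shift_def \<tau>_mult \<delta>_mult R.a_ac R.r_distr)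

end

definition finsupp :: "('a, 'm) ring_scheme \<Rightarrow> ('w \<Rightarrow> 'a) set" where
  "finsupp R = {f. (\<forall>w. f w \<in> carrier R) \<and> finite {w. f w \<noteq> \<zero>\<^bsub>R\<^esub>}}"

lemma (in ring) finsupp_closed: "f \<in> finsupp R \<Longrightarrow> f w \<in> carrier R"
  and finsupp_finite: "f \<in> finsupp R \<Longrightarrow> finite {w. f w \<noteq> \<zero>}"
  by (auto simp: finsupp_def)

lemma (in ring) finsupp_add:
  assumes "f \<in> finsupp R" "g \<in> finsupp R"
  shows "(\<lambda>w. f w \<oplus> g w) \<in> finsupp R"
proof -
  have "{w. f w \<oplus> g w \<noteq> \<zero>} \<subseteq> {w. f w \<noteq> \<zero>} \<union> {w. g w \<noteq> \<zero>}" by auto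
  then show ?thesis
    using assms by (auto simp: finsupp_def intro: finite_subset)
qed

lemma (in ring) finsupp_smult:
  assumes "f \<in> finsupp R" "r \<in> carrier R"
  shows "(\<lambda>w. r \<otimes> f w) \<in> finsupp R"
proof -
  have "{w. r \<otimes> f w \<noteq> \<zero>} \<subseteq> {w. f w \<noteq> \<zero>}" using assms by auto
  then show ?thesis
    using assms by (auto simp: finsupp_def intro: finite_subset)
qed

lemma (in ring) finsupp_unit: "(\<lambda>w. if w = v then \<one> else \<zero>) \<in> finsupp R"
  by (auto simp: finsupp_def intro: finite_subset[of _ "{v}"])

lemma (in skew_derivation) finsupp_moved:
  assumes "f \<in> finsupp R"
  shows "(\<lambda>w. if w \<in> range \<sigma> then \<tau> (f (inv_into UNIV \<sigma> w)) else \<zero>) \<in> finsupp R" (is "?p \<in> _")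
    and "(\<lambda>w. \<delta> (f w)) \<in> finsupp R"
proof -
  have "{w. ?p w \<noteq> \<zero>} \<subseteq> \<sigma> ` {w. f w \<noteq> \<zero>}"
  proof
    fix w assume "w \<in> {w. ?p w \<noteq> \<zero>}"
    then have *: "?p w \<noteq> \<zero>" by blast
    then have "w \<in> range \<sigma>" by presburger
    moreover from this have "f (inv_into UNIV \<sigma> w) \<noteq> \<zero>" using * by auto
    ultimately show "w \<in> \<sigma> ` {w. f w \<noteq> \<zero>}"
      by (auto intro!: image_eqI[of _ _ "inv_into UNIV \<sigma> w"] simp: f_inv_into_f)
  qed
  then have "finite {w. ?p w \<noteq> \<zero>}"
    by (rule finite_subset) (simp add: R.finsupp_finite[OF assms])
  then show "?p \<in> finsupp R"
    using assms by (auto simp: finsupp_def)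
  have "{w. \<delta> (f w) \<noteq> \<zero>} \<subseteq> {w. f w \<noteq> \<zero>}" by auto
  then show "(\<lambda>w. \<delta> (f w)) \<in> finsupp R"
    using assms by (auto simp: finsupp_def intro: finite_subset)
qed

lemma (in skew_derivation) finsupp_shift:
  "f \<in> finsupp R \<Longrightarrow> shift \<sigma> f \<in> finsupp R"
  using R.finsupp_add[OF finsupp_moved] unfolding shift_def[abs_def] by blast


section \<open>Linear combinations\<close>

definition lincomb :: "'a ring \<Rightarrow> 't ring \<Rightarrow> ('a \<Rightarrow> 't) \<Rightarrow> ('w \<Rightarrow> 't) \<Rightarrow> ('w \<Rightarrow> 'a) \<Rightarrow> 't" where
  "lincomb R T g m f = (\<Oplus>\<^bsub>T\<^esub>w\<in>{w. f w \<noteq> \<zero>\<^bsub>R\<^esub>}. g (f w) \<otimes>\<^bsub>T\<^esub> m w)"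

locale ring_map = R: ring R + T: ring T for R :: "'a ring" and T :: "'t ring" +
  fixes g :: "'a \<Rightarrow> 't"
  assumes g_hom: "g \<in> ring_hom R T"
begin

lemmas g_closed [simp] = ring_hom_closed[OF g_hom]
lemmas g_add = ring_hom_add[OF g_hom]
lemmas g_mult = ring_hom_mult[OF g_hom]
lemmas g_one = ring_hom_one[OF g_hom]

lemma g_zero [simp]: "g \<zero>\<^bsub>R\<^esub> = \<zero>\<^bsub>T\<^esub>"
  using ring_hom_zero[OF g_hom R.ring_axioms T.ring_axioms] .

context
  fixes m :: "'w \<Rightarrow> 't"
  assumes m_closed [simp]: "\<And>w. m w \<in> carrier T"
begin

lemma lincomb_closed: "f \<in> finsupp R \<Longrightarrow> lincomb R T g m f \<in> carrier T"
  unfolding lincomb_def by (rule T.finsum_closed) (auto simp: R.finsupp_closed)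

lemma lincomb_superset:
  assumes "f \<in> finsupp R" "finite A" "{w. f w \<noteq> \<zero>\<^bsub>R\<^esub>} \<subseteq> A"
  shows "lincomb R T g m f = (\<Oplus>\<^bsub>T\<^esub>w\<in>A. g (f w) \<otimes>\<^bsub>T\<^esub> m w)"
  unfolding lincomb_def
  by (rule T.add.finprod_mono_neutral_cong_left)
    (use assms in \<open>auto simp: R.finsupp_closed\<close>)

lemma lincomb_add:
  assumes f: "f \<in> finsupp R" and f': "f' \<in> finsupp R"
  shows "lincomb R T g m (\<lambda>w. f w \<oplus>\<^bsub>R\<^esub> f' w) = lincomb R T g m f \<oplus>\<^bsub>T\<^esub> lincomb R T g m f'"
proof -
  let ?A = "{w. f w \<noteq> \<zero>\<^bsub>R\<^esub>} \<union> {w. f' w \<noteq> \<zero>\<^bsub>R\<^esub>}"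
  have A: "finite ?A" using f f' by (simp add: R.finsupp_finite)
  have "lincomb R T g m (\<lambda>w. f w \<oplus>\<^bsub>R\<^esub> f' w) =
      (\<Oplus>\<^bsub>T\<^esub>w\<in>?A. g (f w \<oplus>\<^bsub>R\<^esub> f' w) \<otimes>\<^bsub>T\<^esub> m w)"
    by (rule lincomb_superset[OF R.finsupp_add[OF f f'] A]) auto
  also have "\<dots> = (\<Oplus>\<^bsub>T\<^esub>w\<in>?A. g (f w) \<otimes>\<^bsub>T\<^esub> m w \<oplus>\<^bsub>T\<^esub> g (f' w) \<otimes>\<^bsub>T\<^esub> m w)"
    by (rule T.finsum_cong')
      (auto simp: g_add T.l_distr R.finsupp_closed[OF f] R.finsupp_closed[OF f'])
  also have "\<dots> = (\<Oplus>\<^bsub>T\<^esub>w\<in>?A. g (f w) \<otimes>\<^bsub>T\<^esub> m w) \<oplus>\<^bsub>T\<^esub> (\<Oplus>\<^bsub>T\<^esub>w\<in>?A. g (f' w) \<otimes>\<^bsub>T\<^esub> m w)"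
    by (rule T.finsum_addf) (auto simp: R.finsupp_closed[OF f] R.finsupp_closed[OF f'])
  also have "\<dots> = lincomb R T g m f \<oplus>\<^bsub>T\<^esub> lincomb R T g m f'"
    using lincomb_superset[OF f A] lincomb_superset[OF f' A] by auto
  finally show ?thesis .
qed

lemma lincomb_smult:
  assumes f: "f \<in> finsupp R" and r: "r \<in> carrier R"
  shows "lincomb R T g m (\<lambda>w. r \<otimes>\<^bsub>R\<^esub> f w) = g r \<otimes>\<^bsub>T\<^esub> lincomb R T g m f"
proof -
  let ?A = "{w. f w \<noteq> \<zero>\<^bsub>R\<^esub>}"
  have A: "finite ?A" using f by (simp add: R.finsupp_finite)
  have "lincomb R T g m (\<lambda>w. r \<otimes>\<^bsub>R\<^esub> f w) = (\<Oplus>\<^bsub>T\<^esub>w\<in>?A. g (r \<otimes>\<^bsub>R\<^esub> f w) \<otimes>\<^bsub>T\<^esub> m w)"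
    by (rule lincomb_superset[OF R.finsupp_smult[OF f r] A]) (use r in auto)
  also have "\<dots> = (\<Oplus>\<^bsub>T\<^esub>w\<in>?A. g r \<otimes>\<^bsub>T\<^esub> (g (f w) \<otimes>\<^bsub>T\<^esub> m w))"
    by (rule T.finsum_cong') (use r in \<open>auto simp: g_mult T.m_assoc R.finsupp_closed[OF f]\<close>)
  also have "\<dots> = g r \<otimes>\<^bsub>T\<^esub> (\<Oplus>\<^bsub>T\<^esub>w\<in>?A. g (f w) \<otimes>\<^bsub>T\<^esub> m w)"
    by (rule T.finsum_rdistr[symmetric]) (use r A in \<open>auto simp: R.finsupp_closed[OF f]\<close>)
  finally show ?thesis by (simp add: lincomb_def)
qed

lemma lincomb_unit: "lincomb R T g m (\<lambda>w. if w = v then \<one>\<^bsub>R\<^esub> else \<zero>\<^bsub>R\<^esub>) = m v"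
proof -
  have "lincomb R T g m (\<lambda>w. if w = v then \<one>\<^bsub>R\<^esub> else \<zero>\<^bsub>R\<^esub>) =
      (\<Oplus>\<^bsub>T\<^esub>w\<in>{v}. g (if w = v then \<one>\<^bsub>R\<^esub> else \<zero>\<^bsub>R\<^esub>) \<otimes>\<^bsub>T\<^esub> m w)"
    by (rule lincomb_superset) (auto simp: R.finsupp_unit)
  then show ?thesis by (simp add: g_one)
qed

end

end

text \<open>
  The data that induce a homomorphism from the Ore extension \<open>R[x; \<tau>, \<delta>]\<close> to \<open>T\<close> with \<open>x \<mapsto> t\<close>.
\<close>

locale skew_map = skew_derivation R \<tau> \<delta> + ring_map R T g
  for R :: "'a ring" and \<tau> \<delta> and T :: "'t ring" and g +
  fixes t :: 't
  assumes t_closed [simp]: "t \<in> carrier T"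
    and commute: "r \<in> carrier R \<Longrightarrow> t \<otimes>\<^bsub>T\<^esub> g r = g (\<tau> r) \<otimes>\<^bsub>T\<^esub> t \<oplus>\<^bsub>T\<^esub> g (\<delta> r)"
begin

text \<open>
  This justifies the definition of the skew shift: whenever \<open>m\<close> is a family of elements of \<open>T\<close> on
  which left multiplication by \<open>t\<close> acts through \<open>\<sigma>\<close>, multiplying a linear combination by \<open>t\<close> shifts its
  coefficients. Injectivity of \<open>\<sigma>\<close> prevents terms from colliding.
\<close>

lemma lincomb_shift:
  fixes m :: "'w \<Rightarrow> 't"
  assumes m [simp]: "\<And>w. m w \<in> carrier T" and \<sigma>: "inj \<sigma>"
    and m_\<sigma>: "\<And>w. m (\<sigma> w) = t \<otimes>\<^bsub>T\<^esub> m w" and f: "f \<in> finsupp R"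
  shows "lincomb R T g m (shift \<sigma> f) = t \<otimes>\<^bsub>T\<^esub> lincomb R T g m f"
proof -
  let ?A = "{w. f w \<noteq> \<zero>\<^bsub>R\<^esub>}"
  let ?p = "\<lambda>w. if w \<in> range \<sigma> then \<tau> (f (inv_into UNIV \<sigma> w)) else \<zero>\<^bsub>R\<^esub>"
  let ?q = "\<lambda>w. \<delta> (f w)"
  have A: "finite ?A" using f by (simp add: R.finsupp_finite)
  note [simp] = R.finsupp_closed[OF f]
  have p_supp: "{w. ?p w \<noteq> \<zero>\<^bsub>R\<^esub>} \<subseteq> \<sigma> ` ?A"
    using \<sigma> by (auto split: if_splits)
  have "lincomb R T g m ?p = (\<Oplus>\<^bsub>T\<^esub>w\<in>\<sigma> ` ?A. g (?p w) \<otimes>\<^bsub>T\<^esub> m w)"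
    by (rule lincomb_superset[OF m finsupp_moved(1)[OF f] _ p_supp]) (simp add: A)
  also have "\<dots> = (\<Oplus>\<^bsub>T\<^esub>w\<in>?A. g (?p (\<sigma> w)) \<otimes>\<^bsub>T\<^esub> m (\<sigma> w))"
    by (rule T.finsum_reindex) (use \<sigma> in \<open>auto intro: inj_on_subset\<close>)
  also have "\<dots> = (\<Oplus>\<^bsub>T\<^esub>w\<in>?A. g (\<tau> (f w)) \<otimes>\<^bsub>T\<^esub> t \<otimes>\<^bsub>T\<^esub> m w)"
    by (rule T.finsum_cong') (use \<sigma> in \<open>auto simp: m_\<sigma> T.m_assoc\<close>)
  finally have p: "lincomb R T g m ?p = \<dots>" .
  have q: "lincomb R T g m ?q = (\<Oplus>\<^bsub>T\<^esub>w\<in>?A. g (\<delta> (f w)) \<otimes>\<^bsub>T\<^esub> m w)"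
    by (rule lincomb_superset[OF m finsupp_moved(2)[OF f] A]) auto
  have "t \<otimes>\<^bsub>T\<^esub> lincomb R T g m f = (\<Oplus>\<^bsub>T\<^esub>w\<in>?A. t \<otimes>\<^bsub>T\<^esub> (g (f w) \<otimes>\<^bsub>T\<^esub> m w))"
    unfolding lincomb_def by (rule T.finsum_rdistr) (auto simp: A)
  also have "\<dots> = (\<Oplus>\<^bsub>T\<^esub>w\<in>?A. g (\<tau> (f w)) \<otimes>\<^bsub>T\<^esub> t \<otimes>\<^bsub>T\<^esub> m w \<oplus>\<^bsub>T\<^esub> g (\<delta> (f w)) \<otimes>\<^bsub>T\<^esub> m w)"
    by (rule T.finsum_cong') (auto simp: T.m_assoc[symmetric] commute T.l_distr)
  also have "\<dots> = lincomb R T g m ?p \<oplus>\<^bsub>T\<^esub> lincomb R T g m ?q"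
    unfolding p q by (rule T.finsum_addf) auto
  also have "\<dots> = lincomb R T g m (\<lambda>w. ?p w \<oplus>\<^bsub>R\<^esub> ?q w)"
    by (rule lincomb_add[OF m finsupp_moved[OF f], symmetric])
  also have "(\<lambda>w. ?p w \<oplus>\<^bsub>R\<^esub> ?q w) = shift \<sigma> f"
    by (auto simp: shift_def)
  finally show ?thesis by simp
qed

end


section \<open>The universal property of an Ore extension\<close>

lemma (in ring) finsum_closed_under:
  assumes "finite A" "\<And>a. a \<in> A \<Longrightarrow> u a \<in> carrier R \<and> P (u a)" "P \<zero>"
    and "\<And>r s. r \<in> carrier R \<Longrightarrow> s \<in> carrier R \<Longrightarrow> P r \<Longrightarrow> P s \<Longrightarrow> P (r \<oplus> s)"
  shows "P (\<Oplus>a\<in>A. u a)"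
  using assms(1,2)
proof (induction A rule: finite_induct)
  case (insert a A)
  then have "P (u a \<oplus> (\<Oplus>a\<in>A. u a))"
    by (intro assms(4)) auto
  then show ?case
    using insert by (simp add: Pi_def)
qed (simp add: assms(3))

locale ore = skew_derivation R \<tau> \<delta> for R :: "'a ring" and \<tau> \<delta> +
  fixes \<iota> :: "'a \<Rightarrow> 'b" and S :: "'b ring" and x :: 'b
  assumes ore: "ore_extension R \<tau> \<delta> \<iota> S x"
begin

sublocale skew_map R \<tau> \<delta> S \<iota> x
  using ore skew_derivation_axioms
  by (auto simp: ore_extension_def skew_map_def ring_map_def ring_map_axioms_def
      skew_map_axioms_def skew_derivation_def)

abbreviation from_coeffs :: "(nat \<Rightarrow> 'a) \<Rightarrow> 'b" where
  "from_coeffs \<equiv> lincomb R S \<iota> (\<lambda>n. x [^]\<^bsub>S\<^esub> n)"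

lemma coeffs_unique: "s \<in> carrier S \<Longrightarrow> \<exists>!c. c \<in> finsupp R \<and> s = from_coeffs c"
proof -
  have "c \<in> finsupp R \<and> s = from_coeffs c \<longleftrightarrow> range c \<subseteq> carrier R \<and> finite {n. c n \<noteq> \<zero>\<^bsub>R\<^esub>} \<and>
        s = (\<Oplus>\<^bsub>S\<^esub>n\<in>{n. c n \<noteq> \<zero>\<^bsub>R\<^esub>}. \<iota> (c n) \<otimes>\<^bsub>S\<^esub> x [^]\<^bsub>S\<^esub> n)" for c s
    by (auto simp: finsupp_def lincomb_def)
  moreover assume "s \<in> carrier S"
  ultimately show ?thesis
    using ore by (simp add: ore_extension_def)
qed

lemma generated [consumes 1, case_names base indet add mult]:
  assumes s: "s \<in> carrier S"
    and base: "\<And>r. r \<in> carrier R \<Longrightarrow> P (\<iota> r)" and indet: "P x"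
    and add: "\<And>a b. a \<in> carrier S \<Longrightarrow> b \<in> carrier S \<Longrightarrow> P a \<Longrightarrow> P b \<Longrightarrow> P (a \<oplus>\<^bsub>S\<^esub> b)"
    and mult: "\<And>a b. a \<in> carrier S \<Longrightarrow> b \<in> carrier S \<Longrightarrow> P a \<Longrightarrow> P b \<Longrightarrow> P (a \<otimes>\<^bsub>S\<^esub> b)"
  shows "P s"
proof -
  obtain c where c: "c \<in> finsupp R" "s = from_coeffs c"
    using coeffs_unique[OF s] by blast
  have pow: "P (x [^]\<^bsub>S\<^esub> (n::nat))" for n
    by (induction n) (use base[of "\<one>\<^bsub>R\<^esub>"] indet mult in \<open>auto simp: g_one\<close>)
  show ?thesis
    unfolding c(2) lincomb_def
    by (rule T.finsum_closed_under)
      (use c(1) base[of "\<zero>\<^bsub>R\<^esub>"] base add mult pow in \<open>auto simp: finsupp_def\<close>)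
qed

text \<open>
  The homomorphism has to be \<open>\<Sum> r\<^sub>n x\<^sup>n \<mapsto> \<Sum> g(r\<^sub>n) t\<^sup>n\<close>. By the lemmas on linear combinations it respects
  sums and left multiplication by elements of \<open>R\<close> and by \<open>x\<close>, since the coefficients change in
  the same way on both sides. The elements \<open>a\<close> such that it respects all products \<open>ab\<close> are closed
  under sums and products, so they make up all of \<open>S\<close>. This argument avoids an explicit formula for
  \<open>x\<^sup>n r\<close>.
\<close>

proposition universal:
  assumes "skew_map R \<tau> \<delta> T g t"
  shows "\<exists>h\<in>ring_hom S T. (\<forall>r\<in>carrier R. h (\<iota> r) = g r) \<and> h x = t"
proof -
  interpret U: skew_map R \<tau> \<delta> T g t by fact
  let ?ev = "lincomb R T g (\<lambda>n::nat. t [^]\<^bsub>T\<^esub> n)"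
  define h where "h s = ?ev (THE c. c \<in> finsupp R \<and> s = from_coeffs c)" for s
  have h: "h (from_coeffs c) = ?ev c" if c: "c \<in> finsupp R" for c
  proof -
    have "from_coeffs c \<in> carrier S" by (rule lincomb_closed) (use c in auto)
    from the1_equality[OF coeffs_unique[OF this], of c] show ?thesis
      using c by (simp add: h_def)
  qed
  have coeffs: "\<exists>c\<in>finsupp R. s = from_coeffs c" if "s \<in> carrier S" for s
    using coeffs_unique[OF that] by blast
  have closed: "h s \<in> carrier T" if s: "s \<in> carrier S" for s
  proof -
    obtain c where c: "c \<in> finsupp R" "s = from_coeffs c"
      using coeffs[OF s] by blast
    have "?ev c \<in> carrier T" by (rule U.lincomb_closed) (use c in auto)
    then show ?thesis by (simp add: c h)
  qed
  have add: "h (a \<oplus>\<^bsub>S\<^esub> b) = h a \<oplus>\<^bsub>T\<^esub> h b" if ab: "a \<in> carrier S" "b \<in> carrier S" for a b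
  proof -
    obtain c d where c: "c \<in> finsupp R" "a = from_coeffs c" and d: "d \<in> finsupp R" "b = from_coeffs d"
      using ab coeffs by meson
    have "a \<oplus>\<^bsub>S\<^esub> b = from_coeffs (\<lambda>n. c n \<oplus>\<^bsub>R\<^esub> d n)"
      unfolding c d by (rule lincomb_add[symmetric]) (use c d in auto)
    then show ?thesis
      by (simp add: h R.finsupp_add c d U.lincomb_add)
  qed
  have smult: "h (\<iota> r \<otimes>\<^bsub>S\<^esub> b) = g r \<otimes>\<^bsub>T\<^esub> h b" if r: "r \<in> carrier R" and b: "b \<in> carrier S" for r b
  proof -
    obtain d where d: "d \<in> finsupp R" "b = from_coeffs d"
      using b coeffs by meson
    have "\<iota> r \<otimes>\<^bsub>S\<^esub> b = from_coeffs (\<lambda>n. r \<otimes>\<^bsub>R\<^esub> d n)"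
      unfolding d by (rule lincomb_smult[symmetric]) (use d r in auto)
    then show ?thesis
      by (simp add: h R.finsupp_smult d r U.lincomb_smult)
  qed
  have shift: "h (x \<otimes>\<^bsub>S\<^esub> b) = t \<otimes>\<^bsub>T\<^esub> h b" if b: "b \<in> carrier S" for b
  proof -
    obtain d where d: "d \<in> finsupp R" "b = from_coeffs d"
      using b coeffs by meson
    have "x [^]\<^bsub>S\<^esub> n \<otimes>\<^bsub>S\<^esub> x = x \<otimes>\<^bsub>S\<^esub> x [^]\<^bsub>S\<^esub> n" for n :: nat
      using T.nat_pow_Suc2[of x n] by simp
    then have "x \<otimes>\<^bsub>S\<^esub> b = from_coeffs (shift Suc d)"
      unfolding d by (intro lincomb_shift[symmetric]) (use d in auto)
    moreover have "t [^]\<^bsub>T\<^esub> n \<otimes>\<^bsub>T\<^esub> t = t \<otimes>\<^bsub>T\<^esub> t [^]\<^bsub>T\<^esub> n" for n :: nat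
      using U.T.nat_pow_Suc2[of t n] by simp
    then have "?ev (shift Suc d) = t \<otimes>\<^bsub>T\<^esub> ?ev d"
      by (intro U.lincomb_shift) (use d in auto)
    ultimately show ?thesis
      by (simp add: h finsupp_shift d)
  qed
  have one: "h \<one>\<^bsub>S\<^esub> = \<one>\<^bsub>T\<^esub>"
    using h[OF R.finsupp_unit, of 0]
    by (simp add: lincomb_unit U.lincomb_unit)
  have mult: "\<forall>b\<in>carrier S. h (a \<otimes>\<^bsub>S\<^esub> b) = h a \<otimes>\<^bsub>T\<^esub> h b" if "a \<in> carrier S" for a
    using that
  proof (induction rule: generated)
    case (base r)
    then show ?case
      using smult[OF base T.one_closed] by (simp add: smult one)
  next
    case indet
    then show ?case
      using shift[OF T.one_closed] by (simp add: shift one)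
  next
    case (add a b)
    then show ?case by (simp add: \<open>\<And>a b. _ \<Longrightarrow> _ \<Longrightarrow> h (a \<oplus>\<^bsub>S\<^esub> b) = _\<close> closed T.l_distr U.T.l_distr)
  next
    case (mult a b)
    then show ?case by (simp add: closed T.m_assoc U.T.m_assoc)
  qed
  show ?thesis
  proof (rule bexI[of _ h], intro conjI ballI)
    show "h \<in> ring_hom S T"
      by (rule ring_hom_memI) (use closed add mult one in auto)
    show "h (\<iota> r) = g r" if "r \<in> carrier R" for r
      using smult[OF that T.one_closed] that by (simp add: one)
    show "h x = t"
      using shift[OF T.one_closed] by (simp add: one)
  qed
qed

end


section \<open>Generators of a pushout\<close>

text \<open>
  Let \<open>N\<close> be the subring of elements with property \<open>P\<close>. It contains both images, so the universal
  property gives a retraction \<open>S \<rightarrow> N\<close>. Followed by the inclusion it agrees with the identity of \<open>S\<close>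
  on both images, hence everywhere, and \<open>N = S\<close>.
\<close>

lemma pushout_generated [consumes 7, case_names left right add mult]:
  fixes S :: "'s ring"
  assumes S1: "ring S\<^sub>1"
    and S: "ring S" and \<kappa>: "\<kappa>\<^sub>1 \<in> ring_hom S\<^sub>1 S" "\<kappa>\<^sub>2 \<in> ring_hom S\<^sub>2 S"
    and amalg: "\<forall>r\<in>carrier R. \<kappa>\<^sub>1 (\<iota>\<^sub>1 r) = \<kappa>\<^sub>2 (\<iota>\<^sub>2 r)"
    and univ: "pushout_universal TYPE('s) R \<iota>\<^sub>1 S\<^sub>1 \<iota>\<^sub>2 S\<^sub>2 \<kappa>\<^sub>1 \<kappa>\<^sub>2 S"
    and s: "s \<in> carrier S"
    and left: "\<And>a. a \<in> carrier S\<^sub>1 \<Longrightarrow> P (\<kappa>\<^sub>1 a)" and right: "\<And>b. b \<in> carrier S\<^sub>2 \<Longrightarrow> P (\<kappa>\<^sub>2 b)"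
    and add: "\<And>a b. a \<in> carrier S \<Longrightarrow> b \<in> carrier S \<Longrightarrow> P a \<Longrightarrow> P b \<Longrightarrow> P (a \<oplus>\<^bsub>S\<^esub> b)"
    and mult: "\<And>a b. a \<in> carrier S \<Longrightarrow> b \<in> carrier S \<Longrightarrow> P a \<Longrightarrow> P b \<Longrightarrow> P (a \<otimes>\<^bsub>S\<^esub> b)"
  shows "P s"
proof -
  interpret S1: ring S\<^sub>1 by fact
  interpret S: ring S by fact
  interpret \<kappa>: ring_hom_ring S\<^sub>1 S \<kappa>\<^sub>1
    by (rule ring_hom_ringI2) (use S1 S \<kappa> in auto)
  define N where "N = {s \<in> carrier S. P s}"
  have one: "P \<one>\<^bsub>S\<^esub>" using left[of "\<one>\<^bsub>S\<^sub>1\<^esub>"] by simp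
  (* Negatives come from the image of the first ring: it contains the negative of 1. *)
  have minus_one: "P (\<ominus>\<^bsub>S\<^esub> \<one>\<^bsub>S\<^esub>)" using left[of "\<ominus>\<^bsub>S\<^sub>1\<^esub> \<one>\<^bsub>S\<^sub>1\<^esub>"] by simp
  have minus: "P (\<ominus>\<^bsub>S\<^esub> a)" if "a \<in> carrier S" "P a" for a
    using mult[OF _ that(1) minus_one that(2)] that by (simp add: S.l_minus)
  have "subring N S"
    by (rule S.subringI) (use one add mult minus in \<open>auto simp: N_def\<close>)
  then have T: "ring (S\<lparr>carrier := N\<rparr>)" by (rule S.subring_is_ring)
  have "\<kappa>\<^sub>1 \<in> ring_hom S\<^sub>1 (S\<lparr>carrier := N\<rparr>)" "\<kappa>\<^sub>2 \<in> ring_hom S\<^sub>2 (S\<lparr>carrier := N\<rparr>)"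
    using \<kappa> left right by (auto simp: ring_hom_def N_def)
  from pushout_universal_exists[OF univ T this amalg]
  obtain h where h: "h \<in> ring_hom S (S\<lparr>carrier := N\<rparr>)"
    "\<forall>a\<in>carrier S\<^sub>1. h (\<kappa>\<^sub>1 a) = \<kappa>\<^sub>1 a" "\<forall>b\<in>carrier S\<^sub>2. h (\<kappa>\<^sub>2 b) = \<kappa>\<^sub>2 b"
    by blast
  have h': "h \<in> ring_hom S S"
    using h(1) by (auto simp: ring_hom_def N_def)
  have id: "id \<in> ring_hom S S" by (rule ring_hom_memI) auto
  have "h s = id s"
    by (rule pushout_universal_unique[OF univ S \<kappa> amalg h' h(2,3) id _ _ s]) auto
  moreover have "h s \<in> N" using ring_hom_closed[OF h(1) s] by simp
  ultimately show ?thesis by (simp add: N_def)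
qed


section \<open>Operators on functions of words\<close>

definition scalar_op :: "'a ring \<Rightarrow> 'a \<Rightarrow> ('w \<Rightarrow> 'a) \<Rightarrow> 'w \<Rightarrow> 'a" where
  "scalar_op R r f = (if f \<in> carrier (fun_ring R) then (\<lambda>w. r \<otimes>\<^bsub>R\<^esub> f w) else (\<lambda>w. \<zero>\<^bsub>R\<^esub>))"

context skew_derivation
begin

definition shift_op :: "('w \<Rightarrow> 'w) \<Rightarrow> ('w \<Rightarrow> 'a) \<Rightarrow> 'w \<Rightarrow> 'a" where
  "shift_op \<sigma> f = (if f \<in> carrier (fun_ring R) then shift \<sigma> f else (\<lambda>w. \<zero>))"

lemma skew_map_operators:
  fixes \<sigma> :: "'w \<Rightarrow> 'w"
  shows "skew_map R \<tau> \<delta> (endo_ring (fun_ring R)) (scalar_op R) (shift_op \<sigma>)"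
proof -
  have "scalar_op R \<in> ring_hom R (endo_ring (fun_ring R))"
    by (rule ring_hom_memI)
      (auto simp: scalar_op_def endo_ring_simps fun_ring_simps R.r_distr R.l_distr R.m_assoc fun_eq_iff)
  moreover have "shift_op \<sigma> \<in> carrier (endo_ring (fun_ring R))"
    by (auto simp: shift_op_def endo_ring_simps fun_ring_simps shift_closed shift_add)
  moreover have "shift_op \<sigma> \<circ> scalar_op R r =
      (\<lambda>f w. scalar_op R (\<tau> r) (shift_op \<sigma> f) w \<oplus> scalar_op R (\<delta> r) f w)" if "r \<in> carrier R" for r
  proof
    fix f :: "'w \<Rightarrow> 'a"
    have "shift \<sigma> (\<lambda>w. \<zero>) = (\<lambda>w. \<zero>)" by (simp add: shift_def fun_eq_iff)
    then show "(shift_op \<sigma> \<circ> scalar_op R r) f =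
        (\<lambda>w. scalar_op R (\<tau> r) (shift_op \<sigma> f) w \<oplus> scalar_op R (\<delta> r) f w)"
      using that by (auto simp: shift_op_def scalar_op_def fun_ring_simps shift_closed shift_smult)
  qed
  ultimately show ?thesis
    using skew_derivation_axioms ring_endo_ring[OF abelian_group_fun_ring[OF R.ring_axioms]]
    by (auto simp: skew_map_def ring_map_def ring_map_axioms_def skew_map_axioms_def
        R.ring_axioms endo_ring_simps(2,5) fun_ring_simps(3))
qed

end


section \<open>Rings generated by skew indeterminates acting on words\<close>

text \<open>
  The situation of the theorem, with an arbitrary family of indeterminates \<open>X\<close> and with the
  universal properties replaced by their consequences: \<open>S\<close> acts on functions of words through
  \<open>h\<close>, and it is generated by the image of \<open>R\<close> and the indeterminates.
\<close>

locale word_skew = ring_map R S j for R :: "'a ring" and S :: "'s ring" and j +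
  fixes \<tau> \<delta> :: "'i \<Rightarrow> 'a \<Rightarrow> 'a" and X :: "'i \<Rightarrow> 's"
    and h :: "'s \<Rightarrow> ('i list \<Rightarrow> 'a) \<Rightarrow> 'i list \<Rightarrow> 'a"
  assumes skew: "skew_map R (\<tau> i) (\<delta> i) S j (X i)"
    and h_hom: "h \<in> ring_hom S (endo_ring (fun_ring R))"
    and h_scalar: "r \<in> carrier R \<Longrightarrow> h (j r) = scalar_op R r"
    and h_X: "h (X i) = skew_derivation.shift_op R (\<tau> i) (\<delta> i) (Cons i)"
    and generated: "\<lbrakk>s \<in> carrier S; \<And>r. r \<in> carrier R \<Longrightarrow> P (j r); \<And>i. P (X i);
      \<And>a b. a \<in> carrier S \<Longrightarrow> b \<in> carrier S \<Longrightarrow> P a \<Longrightarrow> P b \<Longrightarrow> P (a \<oplus>\<^bsub>S\<^esub> b);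
      \<And>a b. a \<in> carrier S \<Longrightarrow> b \<in> carrier S \<Longrightarrow> P a \<Longrightarrow> P b \<Longrightarrow> P (a \<otimes>\<^bsub>S\<^esub> b)\<rbrakk> \<Longrightarrow> P s"
begin

sublocale sk: skew_map R "\<tau> i" "\<delta> i" S j "X i" for i
  by (rule skew)

lemma h_closed: "s \<in> carrier S \<Longrightarrow> (\<And>w. f w \<in> carrier R) \<Longrightarrow> h s f w \<in> carrier R"
  using ring_hom_closed[OF h_hom, of s] by (auto simp: endo_ring_simps fun_ring_simps)

lemma h_mult: "a \<in> carrier S \<Longrightarrow> b \<in> carrier S \<Longrightarrow> h (a \<otimes>\<^bsub>S\<^esub> b) f = h a (h b f)"
  using ring_hom_mult[OF h_hom, of a b] by (simp add: endo_ring_simps)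

lemma h_add: "a \<in> carrier S \<Longrightarrow> b \<in> carrier S \<Longrightarrow> h (a \<oplus>\<^bsub>S\<^esub> b) f = (\<lambda>w. h a f w \<oplus>\<^bsub>R\<^esub> h b f w)"
  using ring_hom_add[OF h_hom, of a b] by (simp add: endo_ring_simps fun_ring_simps)

lemma h_one: "(\<And>w. f w \<in> carrier R) \<Longrightarrow> h \<one>\<^bsub>S\<^esub> f = f"
  using ring_hom_one[OF h_hom] by (simp add: endo_ring_simps fun_ring_simps)

lemma h_zero: "h \<zero>\<^bsub>S\<^esub> f = (\<lambda>w. \<zero>\<^bsub>R\<^esub>)"
  using ring_hom_zero[OF h_hom T.ring_axioms ring_endo_ring[OF abelian_group_fun_ring[OF R.ring_axioms]]]
  by (simp add: endo_ring_simps fun_ring_simps)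

lemma h_j: "r \<in> carrier R \<Longrightarrow> (\<And>w. f w \<in> carrier R) \<Longrightarrow> h (j r) f = (\<lambda>w. r \<otimes>\<^bsub>R\<^esub> f w)"
  by (simp add: h_scalar scalar_op_def fun_ring_simps)

lemma h_indet: "(\<And>w. f w \<in> carrier R) \<Longrightarrow> h (X i) f = sk.shift i (Cons i) f"
  by (simp add: h_X sk.shift_op_def fun_ring_simps)

definition monom :: "'i list \<Rightarrow> 's" where
  "monom w = foldr (\<lambda>i s. X i \<otimes>\<^bsub>S\<^esub> s) w \<one>\<^bsub>S\<^esub>"

lemma monom_simps [simp]: "monom [] = \<one>\<^bsub>S\<^esub>" "monom (i # w) = X i \<otimes>\<^bsub>S\<^esub> monom w"
  by (simp_all add: monom_def)

lemma monom_closed [simp]: "monom w \<in> carrier S"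
  by (induction w) auto

abbreviation from_coeffs :: "('i list \<Rightarrow> 'a) \<Rightarrow> 's" where
  "from_coeffs \<equiv> lincomb R S j monom"

text \<open>
  The empty word stands for \<open>1\<close>, so acting on it amounts to expanding \<open>s \<cdot> 1\<close> in words.
\<close>

definition coeffs :: "'s \<Rightarrow> 'i list \<Rightarrow> 'a" where
  "coeffs s = h s (\<lambda>w. if w = [] then \<one>\<^bsub>R\<^esub> else \<zero>\<^bsub>R\<^esub>)"

text \<open>
  On finitely supported functions \<open>from_coeffs\<close> intertwines the representation with left
  multiplication in \<open>S\<close>. Both the elements of \<open>R\<close> and the indeterminates do this by construction of
  their operators, and the property passes to sums and products. Applied to the empty word it shows
  that \<open>s\<close> is determined by its coefficients.
\<close>

lemma from_coeffs_act:
  assumes "s \<in> carrier S"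
  shows "\<forall>f\<in>finsupp R. h s f \<in> finsupp R \<and> from_coeffs (h s f) = s \<otimes>\<^bsub>S\<^esub> from_coeffs f"
  using assms
proof (induction rule: generated[consumes 1, case_names base indet add mult])
  case (base r)
  then show ?case
    by (auto simp: h_j R.finsupp_closed R.finsupp_smult lincomb_smult)
next
  case (indet i)
  have "from_coeffs (sk.shift i (Cons i) f) = X i \<otimes>\<^bsub>S\<^esub> from_coeffs f" if "f \<in> finsupp R" for f
    by (rule sk.lincomb_shift) (use that in auto)
  then show ?case
    by (auto simp: h_indet R.finsupp_closed sk.finsupp_shift)
next
  case (add a b)
  then show ?case
    by (auto simp: h_add R.finsupp_add lincomb_add T.l_distr lincomb_closed)
next
  case (mult a b)
  then show ?case
    by (auto simp: h_mult T.m_assoc lincomb_closed)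
qed

lemma coeffs_finsupp: "s \<in> carrier S \<Longrightarrow> coeffs s \<in> finsupp R"
  and from_coeffs_coeffs: "s \<in> carrier S \<Longrightarrow> from_coeffs (coeffs s) = s"
  using bspec[OF from_coeffs_act R.finsupp_unit[of "[]"]]
  by (simp_all add: coeffs_def lincomb_unit)

lemma coeffs_nonzero: "s \<in> carrier S \<Longrightarrow> s \<noteq> \<zero>\<^bsub>S\<^esub> \<Longrightarrow> \<exists>w. coeffs s w \<noteq> \<zero>\<^bsub>R\<^esub>"
  using from_coeffs_coeffs[of s] by (cases "\<forall>w. coeffs s w = \<zero>\<^bsub>R\<^esub>") (auto simp: lincomb_def)

lemma shift_Cons:
  "(\<And>w. f w \<in> carrier R) \<Longrightarrow> sk.shift i (Cons i) f (k # w) =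
    (if k = i then \<tau> i (f w) else \<zero>\<^bsub>R\<^esub>) \<oplus>\<^bsub>R\<^esub> \<delta> i (f (k # w))"
  by (auto simp: sk.shift_def inv_into_f_f)

lemma foldr_\<tau>_hom: "foldr \<tau> w \<in> ring_hom R R"
proof (induction w)
  case (Cons i w)
  then show ?case
    using ring_hom_trans[OF Cons sk.\<tau>_hom[of i]] by (simp add: comp_def)
qed (auto intro: ring_hom_memI)

lemmas foldr_\<tau>_closed [simp] = ring_hom_closed[OF foldr_\<tau>_hom]

lemma foldr_\<tau>_zero [simp]: "foldr \<tau> w \<zero>\<^bsub>R\<^esub> = \<zero>\<^bsub>R\<^esub>"
  by (rule ring_hom_zero[OF foldr_\<tau>_hom R.ring_axioms R.ring_axioms])

text \<open>
  Top-degree part of the action of a word: a letter \<open>i\<close> takes \<open>r z\<close> to \<open>\<tau>\<^sub>i(r) iz + \<delta>\<^sub>i(r) z\<close>,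
  and the second term is too short to matter. If \<open>f\<close> is supported on words of length at most \<open>n\<close>, the
  values at words of length \<open>length w + n\<close> are thus governed by the automorphisms alone. Longer words \<open>z\<close>
  are included so that the induction can discard the derivation term, which evaluates \<open>w\<close> at a word
  that is longer by one letter.
\<close>

lemma monom_act:
  assumes f: "\<And>w. f w \<in> carrier R" and bound: "\<And>w. length w > n \<Longrightarrow> f w = \<zero>\<^bsub>R\<^esub>"
    and "length z \<ge> length w + n"
  shows "h (monom w) f z =
    (if take (length w) z = w then foldr \<tau> w (f (drop (length w) z)) else \<zero>\<^bsub>R\<^esub>)"
  using assms(3)
proof (induction w arbitrary: z)
  case Nil
  then show ?case by (simp add: h_one f)
next
  case (Cons i w)
  then obtain k z' where z: "z = k # z'" by (cases z) auto
  have closed: "h (monom w) f v \<in> carrier R" for v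
    by (rule h_closed) (use f in auto)
  (* At z, one letter too long for w, the induction hypothesis reads off f beyond its support;
     this is the argument of the derivation in the skew shift. *)
  have "h (monom w) f z = \<zero>\<^bsub>R\<^esub>"
    using Cons by (simp add: bound)
  then show ?case
    using Cons.IH[of z'] Cons.prems by (simp add: h_mult h_indet closed shift_Cons z f)
qed

text \<open>
  Among the words \<open>w\<close> of \<open>a\<close>, only \<open>u\<close> contributes at \<open>u @ v\<close>: another word of the same length is not a
  prefix of \<open>u @ v\<close>, and a shorter one leaves a suffix longer than \<open>v\<close>, where \<open>f\<close> vanishes.
\<close>

lemma act_leading:
  assumes a: "a \<in> carrier S" and f: "\<And>w. f w \<in> carrier R"
    and bound: "\<And>w. length w > length v \<Longrightarrow> f w = \<zero>\<^bsub>R\<^esub>"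
    and bound_a: "\<And>w. length w > length u \<Longrightarrow> coeffs a w = \<zero>\<^bsub>R\<^esub>"
  shows "h a f (u @ v) = coeffs a u \<otimes>\<^bsub>R\<^esub> foldr \<tau> u (f v)"
proof -
  note fin = coeffs_finsupp[OF a]
  (* Adding u to the support avoids the assumption that its coefficient is nonzero. *)
  let ?A = "insert u {w. coeffs a w \<noteq> \<zero>\<^bsub>R\<^esub>}"
  have A: "finite ?A" using fin by (simp add: R.finsupp_finite)
  have act: "h (j r \<otimes>\<^bsub>S\<^esub> s) f w = r \<otimes>\<^bsub>R\<^esub> h s f w" if "r \<in> carrier R" "s \<in> carrier S" for r s w
    using that f by (simp add: h_mult h_j h_closed)
  have sum: "h (\<Oplus>\<^bsub>S\<^esub>w\<in>B. j (coeffs a w) \<otimes>\<^bsub>S\<^esub> monom w) f (u @ v) =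
      (\<Oplus>\<^bsub>R\<^esub>w\<in>B. coeffs a w \<otimes>\<^bsub>R\<^esub> h (monom w) f (u @ v))" if "finite B" for B
    using that
  proof (induction B rule: finite_induct)
    case empty
    then show ?case by (simp add: h_zero)
  next
    case (insert w B)
    then show ?case
      by (simp add: Pi_def h_add act R.finsupp_closed[OF fin] h_closed f)
  qed
  note [simp] = R.finsupp_closed[OF fin] f
  have "a = from_coeffs (coeffs a)" using from_coeffs_coeffs[OF a] by simp
  also have "\<dots> = (\<Oplus>\<^bsub>S\<^esub>w\<in>?A. j (coeffs a w) \<otimes>\<^bsub>S\<^esub> monom w)"
    by (rule lincomb_superset[OF _ fin A]) auto
  finally have "h a f (u @ v) = (\<Oplus>\<^bsub>R\<^esub>w\<in>?A. coeffs a w \<otimes>\<^bsub>R\<^esub> h (monom w) f (u @ v))"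
    using sum[OF A] by simp
  also have "\<dots> = (\<Oplus>\<^bsub>R\<^esub>w\<in>?A. if u = w then coeffs a w \<otimes>\<^bsub>R\<^esub> foldr \<tau> w (f v) else \<zero>\<^bsub>R\<^esub>)"
  proof (rule R.finsum_cong', goal_cases)
    case (3 w)
    then have len: "length w \<le> length u" using bound_a[of w] by fastforce
    have eq: "h (monom w) f (u @ v) = (if take (length w) (u @ v) = w
        then foldr \<tau> w (f (drop (length w) (u @ v))) else \<zero>\<^bsub>R\<^esub>)"
      by (rule monom_act[OF f bound]) (use len in auto)
    show ?case
    proof (cases "length w = length u")
      case True
      then have "take (length w) (u @ v) = u" "drop (length w) (u @ v) = v" by simp_all
      then show ?thesis unfolding eq by (cases "u = w") simp_all
    next
      case False
      then have "f (drop (length w) (u @ v)) = \<zero>\<^bsub>R\<^esub>"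
        using len by (intro bound) auto
      moreover have "u \<noteq> w" using False by blast
      ultimately show ?thesis unfolding eq by simp
    qed
  qed auto
  also have "\<dots> = coeffs a u \<otimes>\<^bsub>R\<^esub> foldr \<tau> u (f v)"
    by (rule R.finsum_singleton) (use A in auto)
  finally show ?thesis .
qed

lemma leading_word:
  assumes "s \<in> carrier S" "s \<noteq> \<zero>\<^bsub>S\<^esub>"
  obtains u where "coeffs s u \<noteq> \<zero>\<^bsub>R\<^esub>" "\<And>w. length w > length u \<Longrightarrow> coeffs s w = \<zero>\<^bsub>R\<^esub>"
proof -
  let ?A = "{w. coeffs s w \<noteq> \<zero>\<^bsub>R\<^esub>}"
  have "finite ?A" using coeffs_finsupp[OF assms(1)] by (rule R.finsupp_finite)
  moreover obtain v where "v \<in> ?A" using coeffs_nonzero[OF assms] by blast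
  ultimately have "Max (length ` ?A) \<in> length ` ?A" and max: "\<forall>w\<in>?A. length w \<le> Max (length ` ?A)"
    by (auto intro!: Max_in)
  then obtain u where u: "u \<in> ?A" "length u = Max (length ` ?A)" by force
  show ?thesis
  proof (rule that[of u])
    show "coeffs s u \<noteq> \<zero>\<^bsub>R\<^esub>" using u by blast
    show "coeffs s w = \<zero>\<^bsub>R\<^esub>" if "length w > length u" for w
      using max u(2) that by force
  qed
qed

theorem prime:
  assumes iso: "\<And>i. \<tau> i \<in> ring_iso R R" and prime_R: "prime_ring R"
  shows "prime_ring S"
  unfolding T.prime_ring_iff
proof (intro conjI ballI impI notI)
  assume "\<one>\<^bsub>S\<^esub> = \<zero>\<^bsub>S\<^esub>"
  then have "(\<lambda>w::'i list. \<one>\<^bsub>R\<^esub>) = (\<lambda>w. \<zero>\<^bsub>R\<^esub>)"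
    using h_one[of "\<lambda>w. \<one>\<^bsub>R\<^esub>"] h_zero by simp
  then show False
    using prime_R by (simp add: R.prime_ring_iff fun_eq_iff)
next
  fix a b
  assume a: "a \<in> carrier S" and b: "b \<in> carrier S"
    and ann: "\<forall>s\<in>carrier S. a \<otimes>\<^bsub>S\<^esub> s \<otimes>\<^bsub>S\<^esub> b = \<zero>\<^bsub>S\<^esub>"
  show "a = \<zero>\<^bsub>S\<^esub> \<or> b = \<zero>\<^bsub>S\<^esub>"
  proof (rule ccontr)
    assume nz: "\<not> ?thesis"
    obtain u where u: "coeffs a u \<noteq> \<zero>\<^bsub>R\<^esub>" "\<And>w. length w > length u \<Longrightarrow> coeffs a w = \<zero>\<^bsub>R\<^esub>"
      by (rule leading_word[OF a]) (use nz in auto)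
    obtain v where v: "coeffs b v \<noteq> \<zero>\<^bsub>R\<^esub>" "\<And>w. length w > length v \<Longrightarrow> coeffs b w = \<zero>\<^bsub>R\<^esub>"
      by (rule leading_word[OF b]) (use nz in auto)
    note [simp] = R.finsupp_closed[OF coeffs_finsupp[OF a]] R.finsupp_closed[OF coeffs_finsupp[OF b]]
    have bij: "bij_betw (foldr \<tau> w) (carrier R) (carrier R)" for w
    proof (induction w)
      case (Cons i w)
      then show ?case
        using bij_betw_trans[OF Cons ring_iso_memE(5)[OF iso[of i]]] by (simp add: comp_def)
    qed (simp add: bij_betw_def)
    have "coeffs a u \<otimes>\<^bsub>R\<^esub> r \<otimes>\<^bsub>R\<^esub> foldr \<tau> u (coeffs b v) = \<zero>\<^bsub>R\<^esub>" if r: "r \<in> carrier R" for r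
    proof -
      have "r \<in> foldr \<tau> u ` carrier R"
        using bij_betw_imp_surj_on[OF bij[of u]] r by simp
      then obtain r' where r': "r' \<in> carrier R" "foldr \<tau> u r' = r" by (elim imageE) simp
      (* The coefficients of r'b; the multiplier r' is chosen so that the twist by u turns it into r. *)
      let ?f = "\<lambda>w. r' \<otimes>\<^bsub>R\<^esub> coeffs b w"
      have "coeffs (a \<otimes>\<^bsub>S\<^esub> j r' \<otimes>\<^bsub>S\<^esub> b) = h a ?f"
        using a b r' h_j[OF r'(1), of "coeffs b"]
        by (simp add: coeffs_def[of "a \<otimes>\<^bsub>S\<^esub> j r' \<otimes>\<^bsub>S\<^esub> b"] h_mult coeffs_def[of b, symmetric])
      then have "h a ?f = (\<lambda>w. \<zero>\<^bsub>R\<^esub>)"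
        using ann r' by (simp add: coeffs_def h_zero)
      moreover have "h a ?f (u @ v) = coeffs a u \<otimes>\<^bsub>R\<^esub> foldr \<tau> u (?f v)"
        by (rule act_leading) (use a u v r' in auto)
      ultimately show ?thesis
        using r r' ring_hom_mult[OF foldr_\<tau>_hom[of u], of r' "coeffs b v"] foldr_\<tau>_closed
        by (simp add: R.m_assoc)
    qed
    then have "foldr \<tau> u (coeffs b v) = \<zero>\<^bsub>R\<^esub>"
      using R.prime_ring_iff[THEN iffD1, OF prime_R] u(1)
        R.finsupp_closed[OF coeffs_finsupp[OF a]]
        foldr_\<tau>_closed[OF R.finsupp_closed[OF coeffs_finsupp[OF b]]]
      by blast
    then have "coeffs b v = \<zero>\<^bsub>R\<^esub>"
      using inj_onD[OF bij_betw_imp_inj_on[OF bij[of u]], of "coeffs b v" "\<zero>\<^bsub>R\<^esub>"] by simp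
    then show False using v by blast
  qed
qed

end

theorem theorem2p5:
  fixes R :: "'a ring" and S\<^sub>1 :: "'b ring" and S\<^sub>2 :: "'c ring" and S :: "'s ring"
    and \<tau>\<^sub>1 \<tau>\<^sub>2 \<delta>\<^sub>1 \<delta>\<^sub>2 :: "'a \<Rightarrow> 'a"
    and \<iota>\<^sub>1 :: "'a \<Rightarrow> 'b" and \<iota>\<^sub>2 :: "'a \<Rightarrow> 'c" and x :: 'b and y :: 'c
    and \<kappa>\<^sub>1 :: "'b \<Rightarrow> 's" and \<kappa>\<^sub>2 :: "'c \<Rightarrow> 's"
  assumes "ring R"
    and "\<tau>\<^sub>1 \<in> ring_iso R R" and "\<tau>\<^sub>2 \<in> ring_iso R R"
    and "left_derivation R \<tau>\<^sub>1 \<delta>\<^sub>1" and "left_derivation R \<tau>\<^sub>2 \<delta>\<^sub>2"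
    and "ore_extension R \<tau>\<^sub>1 \<delta>\<^sub>1 \<iota>\<^sub>1 S\<^sub>1 x" and "ore_extension R \<tau>\<^sub>2 \<delta>\<^sub>2 \<iota>\<^sub>2 S\<^sub>2 y"
    and "amalgamated_product R \<iota>\<^sub>1 S\<^sub>1 \<iota>\<^sub>2 S\<^sub>2 \<kappa>\<^sub>1 \<kappa>\<^sub>2 S"
    and "prime_ring R"
  shows "prime_ring S"
proof -
  interpret R: ring R by fact
  (* Words over two letters: False stands for x and True for y. *)
  let ?M = "fun_ring R :: (bool list \<Rightarrow> 'a) ring"
  interpret S1: ore R \<tau>\<^sub>1 \<delta>\<^sub>1 \<iota>\<^sub>1 S\<^sub>1 x
    by unfold_locales (use assms in \<open>auto simp: ring_iso_def\<close>)
  interpret S2: ore R \<tau>\<^sub>2 \<delta>\<^sub>2 \<iota>\<^sub>2 S\<^sub>2 y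
    by unfold_locales (use assms in \<open>auto simp: ring_iso_def\<close>)
  have S: "ring S" and \<kappa>: "\<kappa>\<^sub>1 \<in> ring_hom S\<^sub>1 S" "\<kappa>\<^sub>2 \<in> ring_hom S\<^sub>2 S"
    and amalg: "\<forall>r\<in>carrier R. \<kappa>\<^sub>1 (\<iota>\<^sub>1 r) = \<kappa>\<^sub>2 (\<iota>\<^sub>2 r)"
    and univ: "pushout_universal TYPE('s) R \<iota>\<^sub>1 S\<^sub>1 \<iota>\<^sub>2 S\<^sub>2 \<kappa>\<^sub>1 \<kappa>\<^sub>2 S"
    using assms by (simp_all add: amalgamated_product_def)
  interpret S: ring S by fact
  obtain h1 where h1: "h1 \<in> ring_hom S\<^sub>1 (endo_ring ?M)"
    "\<forall>r\<in>carrier R. h1 (\<iota>\<^sub>1 r) = scalar_op R r" "h1 x = S1.shift_op (Cons False)"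
    using S1.universal[OF S1.skew_map_operators] by blast
  obtain h2 where h2: "h2 \<in> ring_hom S\<^sub>2 (endo_ring ?M)"
    "\<forall>r\<in>carrier R. h2 (\<iota>\<^sub>2 r) = scalar_op R r" "h2 y = S2.shift_op (Cons True)"
    using S2.universal[OF S2.skew_map_operators] by blast
  have h12: "\<forall>r\<in>carrier R. h1 (\<iota>\<^sub>1 r) = h2 (\<iota>\<^sub>2 r)"
    using h1 h2 by simp
  obtain h where h: "h \<in> ring_hom S (endo_ring ?M)"
    "\<forall>a\<in>carrier S\<^sub>1. h (\<kappa>\<^sub>1 a) = h1 a" "\<forall>b\<in>carrier S\<^sub>2. h (\<kappa>\<^sub>2 b) = h2 b"
    using pushout_universal_exists[OF amalgamated_product_universal
        [OF S1.T.ring_axioms S2.T.ring_axioms S1.g_hom S2.g_hom assms(8)]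
        ring_endo_ring[OF abelian_group_fun_ring[OF R.ring_axioms]] h1(1) h2(1) h12]
    by blast
  (* The common map from R to S, described through either Ore extension. *)
  define j where "j = \<kappa>\<^sub>1 \<circ> \<iota>\<^sub>1"
  have j2: "j r = \<kappa>\<^sub>2 (\<iota>\<^sub>2 r)" if "r \<in> carrier R" for r
    using that amalg by (simp add: j_def)
  have j: "j \<in> ring_hom R S"
    unfolding j_def by (rule ring_hom_trans[OF S1.g_hom \<kappa>(1)])
  define \<tau> where "\<tau> i = (if i then \<tau>\<^sub>2 else \<tau>\<^sub>1)" for i
  define \<delta> where "\<delta> i = (if i then \<delta>\<^sub>2 else \<delta>\<^sub>1)" for i
  define X where "X i = (if i then \<kappa>\<^sub>2 y else \<kappa>\<^sub>1 x)" for i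
  interpret word_skew R S j \<tau> \<delta> X h
  proof (intro word_skew.intro ring_map.intro ring_map_axioms.intro word_skew_axioms.intro
      R.ring_axioms S)
    show "j \<in> ring_hom R S" by (rule j)
    show "h \<in> ring_hom S (endo_ring (fun_ring R))" by (rule h)
    show "h (j r) = scalar_op R r" if "r \<in> carrier R" for r
      using that h(2) h1(2) by (simp add: j_def)
    show "h (X i) = skew_derivation.shift_op R (\<tau> i) (\<delta> i) (Cons i)" for i
      using h h1(3) h2(3) by (simp add: X_def \<tau>_def \<delta>_def)
    have "\<kappa>\<^sub>1 x \<otimes>\<^bsub>S\<^esub> j r = j (\<tau>\<^sub>1 r) \<otimes>\<^bsub>S\<^esub> \<kappa>\<^sub>1 x \<oplus>\<^bsub>S\<^esub> j (\<delta>\<^sub>1 r)" if r: "r \<in> carrier R" for r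
      using arg_cong[OF S1.commute[OF r], of \<kappa>\<^sub>1] r
      by (simp add: j_def ring_hom_mult[OF \<kappa>(1)] ring_hom_add[OF \<kappa>(1)])
    moreover have "\<kappa>\<^sub>2 y \<otimes>\<^bsub>S\<^esub> j r = j (\<tau>\<^sub>2 r) \<otimes>\<^bsub>S\<^esub> \<kappa>\<^sub>2 y \<oplus>\<^bsub>S\<^esub> j (\<delta>\<^sub>2 r)" if r: "r \<in> carrier R" for r
      using arg_cong[OF S2.commute[OF r], of \<kappa>\<^sub>2] r
      by (simp add: j2 ring_hom_mult[OF \<kappa>(2)] ring_hom_add[OF \<kappa>(2)])
    ultimately show "skew_map R (\<tau> i) (\<delta> i) S j (X i)" for i
      using S1.skew_derivation_axioms S2.skew_derivation_axioms S j
        ring_hom_closed[OF \<kappa>(1) S1.t_closed] ring_hom_closed[OF \<kappa>(2) S2.t_closed]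
      by (auto simp: skew_map_def ring_map_def ring_map_axioms_def skew_map_axioms_def
          R.ring_axioms X_def \<tau>_def \<delta>_def)
  next
    fix s P
    assume s: "s \<in> carrier S" and base: "\<And>r. r \<in> carrier R \<Longrightarrow> P (j r)" and indet: "\<And>i. P (X i)"
      and add: "\<And>a b. a \<in> carrier S \<Longrightarrow> b \<in> carrier S \<Longrightarrow> P a \<Longrightarrow> P b \<Longrightarrow> P (a \<oplus>\<^bsub>S\<^esub> b)"
      and mult: "\<And>a b. a \<in> carrier S \<Longrightarrow> b \<in> carrier S \<Longrightarrow> P a \<Longrightarrow> P b \<Longrightarrow> P (a \<otimes>\<^bsub>S\<^esub> b)"
    show "P s"
      using S1.T.ring_axioms S \<kappa> amalg univ s
    proof (induction rule: pushout_generated)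
      case (left a)
      then show ?case
      proof (induction rule: S1.generated)
        case (base r)
        then show ?case using \<open>\<And>r. r \<in> carrier R \<Longrightarrow> P (j r)\<close> by (simp add: j_def)
      qed (use indet[of False] add mult ring_hom_closed[OF \<kappa>(1)] in
          \<open>auto simp: X_def ring_hom_add[OF \<kappa>(1)] ring_hom_mult[OF \<kappa>(1)]\<close>)
    next
      case (right b)
      then show ?case
      proof (induction rule: S2.generated)
        case (base r)
        then show ?case using \<open>\<And>r. r \<in> carrier R \<Longrightarrow> P (j r)\<close> by (simp add: j2)
      qed (use indet[of True] add mult ring_hom_closed[OF \<kappa>(2)] in
          \<open>auto simp: X_def ring_hom_add[OF \<kappa>(2)] ring_hom_mult[OF \<kappa>(2)]\<close>)
    qed (use add mult in auto)
  qed
  show ?thesis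
    by (rule prime) (use assms in \<open>auto simp: \<tau>_def\<close>)
qed

end
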